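(* Let $\mathbf A$ be a finite solvable algebra with a Malcev term. Then there is a finite sequence of primes $p_1,\dots,p_h$ such that $\mathrm{nuP}_{\mathbf A}\subseteq\mathsf{nuDet}_{p_1}\circ\cdots\circ\mathsf{nuDet}_{p_h}$.
   Context: A finite algebra has finite universe and finitely many basic operations. An $n$-ary circuit over $\mathbf A$ is a DAG with one output node, sources labelled by variables or constants from $A$, gates labelled by basic operations; size is nodes plus edges. A NuDFA over $\mathbf A$ is $(\{t_n\}_{n\ge1},\iota,S)$ with $t_n$ an $n$-ary circuit, $\iota:\{0,1\}\to A$, $S\subseteq A$, accepting $b\in\{0,1\}^n$ iff $t_n(\iota(b_1),\dots,\iota(b_n))\in S$; polynomial size means size of $t_n$ polynomial in $n$; $\mathrm{nuP}_{\mathbf A}$ is the class of languages over $\{0,1\}$ accepted by polynomial-size NuDFAs over $\mathbf A$. A Malcev term is a ternary term $d$ with $d(x,y,y)=d(y,y,x)=x$; solvability is in the sense of commutator theory. An ABP over $\mathrm{GF}(p)$ is a directed acyclic multigraph with one source and one sink, edges labelled by variables or constants of $\mathrm{GF}(p)$; it computes the sum over source–sink paths of the products of labels; size is vertices plus edges. A $\mathrm{BABP}_p$ gate is labelled by an ABP over $\mathrm{GF}(p)$ and $T\subseteq\mathrm{GF}(p)$ and outputs 1 on Boolean inputs iff the polynomial value lies in $T$; its size is the ABP's size. $\mathsf{nuDet}_{p_1}\circ\cdots\circ\mathsf{nuDet}_{p_h}$ is the class of languages $L\subseteq\{0,1\}^*$ such that for each $n$, $L\cap\{0,1\}^n$ is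 recognized by a layered circuit whose top layer is a single $\mathrm{BABP}_{p_1}$ gate, whose layer $i$ consists of $\mathrm{BABP}_{p_i}$ gates taking inputs from layer $i+1$, and whose bottom layer of $\mathrm{BABP}_{p_h}$ gates reads the input bits, of total size (edges plus sum of gate sizes) polynomial in $n$. *)

theory Defs
  imports "HOL-Computational_Algebra.Primes"
begin

text \<open>An algebra is given by its universe A and a finite list of basic
operations, each an arity together with a function on argument lists.\<close>

type_synonym 'a ops = "(nat \<times> ('a list \<Rightarrow> 'a)) list"

definition finite_algebra :: "'a set \<Rightarrow> 'a ops \<Rightarrow> bool" where
  "finite_algebra A ops \<longleftrightarrow> finite A \<and> A \<noteq> {} \<and>
     (\<forall>k < length ops. \<forall>xs. length xs = fst (ops ! k) \<and> set xs \<subseteq> A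
        \<longrightarrow> snd (ops ! k) xs \<in> A)"

datatype 'v trm = TVar 'v | TOp nat "'v trm list"

fun teval :: "'a ops \<Rightarrow> ('v \<Rightarrow> 'a) \<Rightarrow> 'v trm \<Rightarrow> 'a" where
  "teval ops env (TVar v) = env v"
| "teval ops env (TOp k ts) = snd (ops ! k) (map (teval ops env) ts)"

fun twf :: "'a ops \<Rightarrow> 'v trm \<Rightarrow> bool" where
  "twf ops (TVar v) = True"
| "twf ops (TOp k ts) = (k < length ops \<and> length ts = fst (ops ! k) \<and> (\<forall>t\<in>set ts. twf ops t))"

fun tvars :: "'v trm \<Rightarrow> 'v set" where
  "tvars (TVar v) = {v}"
| "tvars (TOp k ts) = (\<Union>t\<in>set ts. tvars t)"

definition has_malcev :: "'a set \<Rightarrow> 'a ops \<Rightarrow> bool" where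
  "has_malcev A ops \<longleftrightarrow> (\<exists>d :: nat trm. twf ops d \<and> tvars d \<subseteq> {0, 1, 2} \<and>
     (\<forall>x\<in>A. \<forall>y\<in>A.
        teval ops (\<lambda>i. if i = 0 then x else y) d = x \<and>
        teval ops (\<lambda>i. if i = 2 then x else y) d = x))"

definition is_cong :: "'a set \<Rightarrow> 'a ops \<Rightarrow> 'a rel \<Rightarrow> bool" where
  "is_cong A ops \<theta> \<longleftrightarrow> equiv A \<theta> \<and>
     (\<forall>k < length ops. \<forall>xs ys. length xs = fst (ops ! k) \<and> length ys = length xs \<and>
        (\<forall>i < length xs. (xs ! i, ys ! i) \<in> \<theta>)
        \<longrightarrow> (snd (ops ! k) xs, snd (ops ! k) ys) \<in> \<theta>)"

text \<open>C(alpha, beta; gamma): alpha centralizes beta modulo gamma (term condition).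
  The variables of a term are split into the x-variables (Inl) and y-variables (Inr).\<close>

definition centralizes :: "'a ops \<Rightarrow> 'a rel \<Rightarrow> 'a rel \<Rightarrow> 'a rel \<Rightarrow> bool" where
  "centralizes ops \<alpha> \<beta> \<gamma> \<longleftrightarrow>
     (\<forall>t :: (nat + nat) trm. twf ops t \<longrightarrow>
       (\<forall>f f' g g'. (\<forall>i. (f i, f' i) \<in> \<alpha>) \<longrightarrow> (\<forall>j. (g j, g' j) \<in> \<beta>) \<longrightarrow>
          (teval ops (case_sum f g) t, teval ops (case_sum f g') t) \<in> \<gamma> \<longrightarrow>
          (teval ops (case_sum f' g) t, teval ops (case_sum f' g') t) \<in> \<gamma>))"

definition commutator :: "'a set \<Rightarrow> 'a ops \<Rightarrow> 'a rel \<Rightarrow> 'a rel \<Rightarrow> 'a rel" where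
  "commutator A ops \<alpha> \<beta> = \<Inter> {\<gamma>. is_cong A ops \<gamma> \<and> centralizes ops \<alpha> \<beta> \<gamma>}"

fun derived :: "'a set \<Rightarrow> 'a ops \<Rightarrow> nat \<Rightarrow> 'a rel" where
  "derived A ops 0 = A \<times> A"
| "derived A ops (Suc k) = commutator A ops (derived A ops k) (derived A ops k)"

definition solvable :: "'a set \<Rightarrow> 'a ops \<Rightarrow> bool" where
  "solvable A ops \<longleftrightarrow> (\<exists>k. derived A ops k = Id_on A)"

text \<open>A circuit is a list of nodes in topological order; a gate refers to earlier
  nodes (one edge per argument). The output node is the last node.\<close>

datatype 'a cnode = CIn nat | CConst 'a | CGate nat "nat list"

definition circuit_wf :: "'a set \<Rightarrow> 'a ops \<Rightarrow> nat \<Rightarrow> 'a cnode list \<Rightarrow> bool" where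
  "circuit_wf A ops n C \<longleftrightarrow> C \<noteq> [] \<and>
     (\<forall>i < length C. case C ! i of
        CIn j \<Rightarrow> j < n
      | CConst a \<Rightarrow> a \<in> A
      | CGate k js \<Rightarrow> k < length ops \<and> length js = fst (ops ! k) \<and> (\<forall>j\<in>set js. j < i))"

fun node_edges :: "'a cnode \<Rightarrow> nat" where
  "node_edges (CGate k js) = length js"
| "node_edges _ = 0"

definition circuit_size :: "'a cnode list \<Rightarrow> nat" where
  "circuit_size C = length C + sum_list (map node_edges C)"

fun node_val :: "'a ops \<Rightarrow> 'a list \<Rightarrow> 'a list \<Rightarrow> 'a cnode \<Rightarrow> 'a" where
  "node_val ops x vs (CIn j) = x ! j"
| "node_val ops x vs (CConst a) = a"
| "node_val ops x vs (CGate k js) = snd (ops ! k) (map (\<lambda>j. vs ! j) js)"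

definition circuit_eval :: "'a ops \<Rightarrow> 'a cnode list \<Rightarrow> 'a list \<Rightarrow> 'a" where
  "circuit_eval ops C x = last (foldl (\<lambda>vs g. vs @ [node_val ops x vs g]) [] C)"

definition nuP :: "'a set \<Rightarrow> 'a ops \<Rightarrow> bool list set set" where
  "nuP A ops = {L. \<exists>(t :: nat \<Rightarrow> 'a cnode list) (\<iota> :: bool \<Rightarrow> 'a) S.
      range \<iota> \<subseteq> A \<and> S \<subseteq> A \<and>
      (\<forall>n\<ge>1. circuit_wf A ops n (t n)) \<and>
      (\<exists>c d :: nat. \<forall>n\<ge>1. circuit_size (t n) \<le> c * n ^ d + c) \<and>
      L = {b. length b \<ge> 1 \<and> circuit_eval ops (t (length b)) (map \<iota> b) \<in> S}}"

datatype alab = AVar nat | AConst nat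

text \<open>An ABP: vertices 0..<V (numbered topologically), source 0, sink V-1,
  edges (u, v, label) with u < v.\<close>

type_synonym abp = "nat \<times> (nat \<times> nat \<times> alab) list"

definition abp_wf :: "nat \<Rightarrow> nat \<Rightarrow> abp \<Rightarrow> bool" where
  "abp_wf p m P \<longleftrightarrow> (case P of (V, E) \<Rightarrow> V \<ge> 1 \<and>
     (\<forall>(u, v, l)\<in>set E. u < v \<and> v < V \<and>
        (case l of AVar j \<Rightarrow> j < m | AConst c \<Rightarrow> c < p)) \<and>
     (\<forall>v. 0 < v \<and> v < V \<longrightarrow> (\<exists>(u, w, l)\<in>set E. w = v)) \<and>
     (\<forall>v. v < V - 1 \<longrightarrow> (\<exists>(u, w, l)\<in>set E. u = v)))"

definition abp_size :: "abp \<Rightarrow> nat" where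
  "abp_size P = fst P + length (snd P)"

fun is_path :: "(nat \<times> nat \<times> alab) list \<Rightarrow> nat \<Rightarrow> nat \<Rightarrow> nat list \<Rightarrow> bool" where
  "is_path E s t [] = (s = t)"
| "is_path E s t (i # is) = (i < length E \<and> fst (E ! i) = s \<and> is_path E (fst (snd (E ! i))) t is)"

fun lab_val :: "bool list \<Rightarrow> alab \<Rightarrow> int" where
  "lab_val x (AVar j) = (if x ! j then 1 else 0)"
| "lab_val x (AConst c) = int c"

definition abp_val :: "nat \<Rightarrow> abp \<Rightarrow> bool list \<Rightarrow> int" where
  "abp_val p P x = (case P of (V, E) \<Rightarrow>
     (\<Sum>es\<in>{es. is_path E 0 (V - 1) es}. prod_list (map (\<lambda>i. lab_val x (snd (snd (E ! i)))) es))
       mod int p)"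

text \<open>A BABP gate: input wires, an ABP over the wire variables, and an accepting set T.\<close>

type_synonym gate = "nat list \<times> abp \<times> int set"

definition gate_wf :: "nat \<Rightarrow> nat \<Rightarrow> gate \<Rightarrow> bool" where
  "gate_wf p s g \<longleftrightarrow> (case g of (ws, P, T) \<Rightarrow>
     (\<forall>w\<in>set ws. w < s) \<and> abp_wf p (length ws) P \<and> T \<subseteq> {0..<int p})"

definition gate_out :: "nat \<Rightarrow> bool list \<Rightarrow> gate \<Rightarrow> bool" where
  "gate_out p y g = (case g of (ws, P, T) \<Rightarrow> abp_val p P (map (\<lambda>w. y ! w) ws) \<in> T)"

definition gate_size :: "gate \<Rightarrow> nat" where
  "gate_size g = (case g of (ws, P, T) \<Rightarrow> length ws + abp_size P)"

text \<open>Layers listed top (layer 1) to bottom (layer h); layer i uses prime ps!i.\<close>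

fun layers_wf :: "nat \<Rightarrow> nat list \<Rightarrow> gate list list \<Rightarrow> bool" where
  "layers_wf n [] [] = True"
| "layers_wf n (p # ps) (L # Ls) =
     ((\<forall>g\<in>set L. gate_wf p (if Ls = [] then n else length (hd Ls)) g) \<and> layers_wf n ps Ls)"
| "layers_wf n _ _ = False"

fun layers_eval :: "nat list \<Rightarrow> gate list list \<Rightarrow> bool list \<Rightarrow> bool list" where
  "layers_eval (p # ps) (L # Ls) x = map (gate_out p (layers_eval ps Ls x)) L"
| "layers_eval _ _ x = x"

definition layers_size :: "gate list list \<Rightarrow> nat" where
  "layers_size Ls = sum_list (map (\<lambda>L. sum_list (map gate_size L)) Ls)"

definition nuDet :: "nat list \<Rightarrow> bool list set set" where
  "nuDet ps = {L. ps \<noteq> [] \<and> (\<exists>c d :: nat. \<forall>n. \<exists>Ls.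
      layers_wf n ps Ls \<and> length (hd Ls) = 1 \<and> layers_size Ls \<le> c * n ^ d + c \<and>
      (\<forall>x. length x = n \<longrightarrow> (x \<in> L \<longleftrightarrow> hd (layers_eval ps Ls x))))}"

end

theory Submission
  imports Defs "HOL-Algebra.Group" "HOL-Number_Theory.Cong"
begin

text \<open>Walk down the derived series, refined so that consecutive congruences \<open>\<gamma> \<subseteq> \<delta>\<close> have
  elementary abelian \<open>p\<close>-groups as blocks of \<open>\<delta>\<close> modulo \<open>\<gamma>\<close> (with \<open>d(x, y, z) = x - y + z\<close>). Suppose
  the bits telling in which \<open>\<delta>\<close>-block each circuit node lies are known. Once the blocks of the
  arguments are fixed, every basic operation is affine modulo \<open>\<gamma>\<close>, so the values at all nodes of the
  affine maps from \<open>\<delta>\<close>-blocks modulo \<open>\<gamma>\<close> to \<open>GF(p)\<close> satisfy a triangular linear system whose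
  coefficients are conjunctions of the known bits. Branching programs over \<open>GF(p)\<close> solve such
  systems, and the affine maps separate the points of a block modulo \<open>\<gamma>\<close>. Hence three layers of
  gates suffice to pass from \<open>\<delta>\<close> to \<open>\<gamma>\<close>.\<close>

subsection \<open>Branching programs for triangular linear systems\<close>

text \<open>A shared node may occur exponentially often when a circuit is unfolded; a linear system
  keeps a bounded number of unknowns per node instead. The unknowns are the
  \<open>\<chi> (v x j)\<close> for all nodes \<open>j\<close> and all \<open>\<chi>\<close> that
  are affine on every \<delta>-block. Freezing all arguments but one of an operation at block
  representatives turns \<open>\<chi>\<close> into another such map. The finite set of these maps is
  thus closed under passing to arguments, and its cardinality depends only on the algebra. An edge
  of a branching program carries a single bit, so the conjunctions that select the blocks of a
  gate's arguments need a layer of their own. A second layer solves the system and tests every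
  unknown against every residue; a third joins these tests. A gate sees only the layer directly
  below it, so inputs, their negations and block bits are copied upwards as long as later layers
  read them. The primes come from the derived series and its refinement, hence from the algebra
  alone, and a bounded number of polynomial size increases stays polynomial.\<close>

definition path_sum :: "(nat \<times> nat \<times> alab) list \<Rightarrow> bool list \<Rightarrow> nat \<Rightarrow> nat \<Rightarrow> int" where
  "path_sum E x s t =
     (\<Sum>es\<in>{es. is_path E s t es}. prod_list (map (\<lambda>i. lab_val x (snd (snd (E ! i)))) es))"

lemma is_path_increasing:
  assumes "\<forall>e\<in>set E. fst e < fst (snd e)" and "is_path E s t es"
  shows "s \<le> t \<and> (s = t \<longrightarrow> es = [])"
  using assms(2)
proof (induction es arbitrary: s)
  case (Cons i es)
  then have "E ! i \<in> set E" by simp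
  then have "fst (E ! i) < fst (snd (E ! i))" using assms(1) by blast
  with Cons show ?case by fastforce
qed simp

text \<open>Induction on the distance to \<open>t\<close>, which the first edge of a path strictly
  decreases. Finiteness matters because a sum over an infinite set of paths would be 0 by
  convention.\<close>

lemma finite_paths:
  assumes "\<forall>e\<in>set E. fst e < fst (snd e)"
  shows "finite {es. is_path E s t es}"
proof (induction "t - s" arbitrary: s rule: less_induct)
  case less
  show ?case
  proof (cases "s < t")
    case False
    then have "{es. is_path E s t es} \<subseteq> {[]}"
      using is_path_increasing[OF assms] by force
    then show ?thesis by (rule finite_subset) simp
  next
    case True
    have "{es. is_path E s t es} \<subseteq>
        (\<Union>i\<in>{i. i < length E \<and> fst (E ! i) = s}. (#) i ` {es. is_path E (fst (snd (E ! i))) t es})"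
    proof
      fix es assume "es \<in> {es. is_path E s t es}"
      with True show "es \<in> (\<Union>i\<in>{i. i < length E \<and> fst (E ! i) = s}.
          (#) i ` {es. is_path E (fst (snd (E ! i))) t es})"
        by (cases es) auto
    qed
    moreover have "finite {es. is_path E (fst (snd (E ! i))) t es}"
      if "i < length E \<and> fst (E ! i) = s" for i
    proof -
      have "E ! i \<in> set E" using that by simp
      then have "fst (E ! i) < fst (snd (E ! i))" using assms by blast
      with that True show ?thesis by (intro less) auto
    qed
    ultimately show ?thesis by (auto elim!: finite_subset)
  qed
qed

lemma path_sum_sink:
  assumes "\<forall>e\<in>set E. fst e < fst (snd e)"
  shows "path_sum E x t t = 1"
proof -
  have "{es. is_path E t t es} = {[]}"
    using is_path_increasing[OF assms] by fastforce
  then show ?thesis by (simp add: path_sum_def)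
qed

text \<open>Paths are sorted by their first edge, which exists because \<open>s \<noteq> t\<close>.
  This replaces a sum over possibly exponentially many paths by a recursion towards the sink.
  Parallel edges count separately, as paths are lists of edge indices.\<close>

lemma path_sum_step:
  assumes inc: "\<forall>e\<in>set E. fst e < fst (snd e)" and "s \<noteq> t"
  shows "path_sum E x s t = sum_list (map (\<lambda>e. if fst e = s
           then lab_val x (snd (snd e)) * path_sum E x (fst (snd e)) t else 0) E)"
proof -
  let ?I = "{i. i < length E \<and> fst (E ! i) = s}"
  let ?P = "\<lambda>i. {es. is_path E (fst (snd (E ! i))) t es}"
  let ?l = "\<lambda>i. lab_val x (snd (snd (E ! i)))"
  have eq: "{es. is_path E s t es} = (\<Union>i\<in>?I. (#) i ` ?P i)"
  proof (intro Set.set_eqI)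
    fix es show "es \<in> {es. is_path E s t es} \<longleftrightarrow> es \<in> (\<Union>i\<in>?I. (#) i ` ?P i)"
      using \<open>s \<noteq> t\<close> by (cases es) auto
  qed
  have "path_sum E x s t = (\<Sum>i\<in>?I. \<Sum>es\<in>(#) i ` ?P i. prod_list (map ?l es))"
    unfolding path_sum_def eq
    by (rule sum.UNION_disjoint) (auto simp: finite_paths[OF inc])
  also have "\<dots> = (\<Sum>i\<in>?I. ?l i * path_sum E x (fst (snd (E ! i))) t)"
    by (rule sum.cong) (auto simp: sum.reindex path_sum_def sum_distrib_left)
  also have "\<dots> = (\<Sum>i = 0..<length E. if fst (E ! i) = s
      then ?l i * path_sum E x (fst (snd (E ! i))) t else 0)"
    by (rule sum.mono_neutral_cong_left) auto
  also have "\<dots> = sum_list (map (\<lambda>e. if fst e = s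
           then lab_val x (snd (snd e)) * path_sum E x (fst (snd e)) t else 0) E)"
    by (simp add: sum_list_sum_nth)
  finally show ?thesis .
qed

text \<open>The branching program of a linear program in which variable \<open>i > 0\<close> is the sum of
  \<open>y\<^sub>b * W\<^sub>u\<close> over the pairs \<open>(u, b)\<close> in row \<open>i\<close>, and variable \<open>0\<close> is the constant one.
  Variable \<open>i\<close> sits at vertex \<open>N - i\<close>. The edges labelled \<open>0\<close> only serve to give every
  vertex the incoming and outgoing edges that well-formedness demands.\<close>

definition lin_edges :: "nat \<Rightarrow> (nat \<Rightarrow> (nat \<times> nat) list) \<Rightarrow> (nat \<times> nat \<times> alab) list" where
  "lin_edges N R = map (\<lambda>v. (v, Suc v, AConst 0)) [0..<N] @
     concat (map (\<lambda>i. map (\<lambda>(u, b). (N - i, N - u, AVar b)) (R i)) [1..<Suc N])"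

lemma lin_edges_increasing:
  assumes "\<And>i u b. \<lbrakk>1 \<le> i; i \<le> N; (u, b) \<in> set (R i)\<rbrakk> \<Longrightarrow> u < i"
  shows "\<forall>e\<in>set (lin_edges N R). fst e < fst (snd e)"
  using assms by (fastforce simp: lin_edges_def)

lemma length_lin_edges:
  assumes "\<And>i. \<lbrakk>1 \<le> i; i \<le> N\<rbrakk> \<Longrightarrow> length (R i) \<le> M"
  shows "length (lin_edges N R) \<le> N + N * M"
proof -
  have "sum_list (map (length \<circ> (\<lambda>i. map (\<lambda>(u, b). (N - i, N - u, AVar b)) (R i))) [1..<Suc N])
      \<le> sum_list (map (\<lambda>i. M) [1..<Suc N])"
    by (rule sum_list_mono) (use assms in auto)
  then show ?thesis
    by (simp add: lin_edges_def length_concat sum_list_triv del: upt_Suc)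
qed

lemma sum_list_concat_map:
  "sum_list (concat xss) = sum_list (map sum_list xss)"
  by (induction xss) (auto simp: add.assoc)

text \<open>Strong induction on \<open>i\<close>: besides an edge labelled 0, the edges leaving
  vertex \<open>N - i\<close> are the entries of row \<open>i\<close>, and they lead to vertices of
  smaller variables. \<open>W\<close> has to satisfy the equations only modulo \<open>p\<close>, so
  it may consist of small residues while the path sums are large integers.\<close>

lemma path_sum_lin_edges:
  fixes W :: "nat \<Rightarrow> nat"
  assumes lt: "\<And>i u b. \<lbrakk>1 \<le> i; i \<le> N; (u, b) \<in> set (R i)\<rbrakk> \<Longrightarrow> u < i"
    and W0: "[W 0 = 1] (mod p)"
    and W: "\<And>i. \<lbrakk>1 \<le> i; i \<le> N\<rbrakk> \<Longrightarrow> [W i = (\<Sum>(u, b)\<leftarrow>R i. if y ! b then W u else 0)] (mod p)"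
    and "i \<le> N"
  shows "[path_sum (lin_edges N R) y (N - i) N = int (W i)] (mod int p)"
  using \<open>i \<le> N\<close>
proof (induction i rule: less_induct)
  case (less i)
  have inc: "\<forall>e\<in>set (lin_edges N R). fst e < fst (snd e)"
    by (rule lin_edges_increasing) (rule lt)
  let ?S = "\<lambda>v. path_sum (lin_edges N R) y v N"
  show ?case
  proof (cases "i = 0")
    case True
    then show ?thesis using W0 path_sum_sink[OF inc]
      by (metis cong_int_iff cong_sym diff_zero of_nat_1)
  next
    case False
    let ?h = "\<lambda>e. if fst e = N - i then lab_val y (snd (snd e)) * ?S (fst (snd e)) else 0"
    have "?S (N - i) = sum_list (map ?h (lin_edges N R))"
      using False less.prems by (intro path_sum_step[OF inc]) auto
    also have "\<dots> = sum_list (map ?h (concat (map (\<lambda>i. map (\<lambda>(u, b). (N - i, N - u, AVar b)) (R i)) [1..<Suc N])))"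
      by (simp add: lin_edges_def comp_def sum_list_0 del: upt_Suc cong: if_cong)
    also have "\<dots> = (\<Sum>k\<leftarrow>[1..<Suc N]. \<Sum>(u, b)\<leftarrow>R k. if N - k = N - i then (if y ! b then 1 else 0) * ?S (N - u) else 0)"
      by (simp add: map_concat sum_list_concat_map comp_def case_prod_unfold del: upt_Suc cong: if_cong)
    also have "\<dots> = (\<Sum>k\<in>{1..<Suc N}. \<Sum>(u, b)\<leftarrow>R k. if N - k = N - i then (if y ! b then 1 else 0) * ?S (N - u) else 0)"
      by (simp add: interv_sum_list_conv_sum_set_nat del: upt_Suc)
    also have "\<dots> = (\<Sum>k\<in>{1..<Suc N}. if k = i then (\<Sum>(u, b)\<leftarrow>R k. (if y ! b then 1 else 0) * ?S (N - u)) else 0)"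
    proof (rule sum.cong)
      fix k assume "k \<in> {1..<Suc N}"
      then have "N - k = N - i \<longleftrightarrow> k = i" using less.prems by auto
      then show "(\<Sum>(u, b)\<leftarrow>R k. if N - k = N - i then (if y ! b then 1 else 0) * ?S (N - u) else 0) =
        (if k = i then (\<Sum>(u, b)\<leftarrow>R k. (if y ! b then 1 else 0) * ?S (N - u)) else 0)"
        by (simp add: case_prod_unfold sum_list_0)
    qed simp
    also have "\<dots> = (\<Sum>(u, b)\<leftarrow>R i. (if y ! b then 1 else 0) * ?S (N - u))"
      using False less.prems by simp
    finally have S: "?S (N - i) = (\<Sum>(u, b)\<leftarrow>R i. (if y ! b then 1 else 0) * ?S (N - u))" .
    have cl: "[(\<Sum>(u, b)\<leftarrow>xs. (if y ! b then 1 else 0) * ?S (N - u)) =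
        int (\<Sum>(u, b)\<leftarrow>xs. if y ! b then W u else 0)] (mod int p)"
      if "set xs \<subseteq> set (R i)" for xs
      using that
    proof (induction xs)
      case (Cons a xs)
      obtain u b where a: "a = (u, b)" by fastforce
      then have "u < i" using lt[of i u b] False less.prems Cons.prems by auto
      then have "[?S (N - u) = int (W u)] (mod int p)" using less by auto
      with Cons a show ?case by (auto intro!: cong_add)
    qed simp
    have "[int (\<Sum>(u, b)\<leftarrow>R i. if y ! b then W u else 0) = int (W i)] (mod int p)"
      using W[of i] False less.prems cong_int_iff cong_sym by (metis One_nat_def Suc_leI neq0_conv)
    with cl[of "R i"] show ?thesis unfolding S using cong_trans by blast
  qed
qed

text \<open>The bound counts \<open>s\<close> wires, \<open>N + 1\<close> vertices, \<open>N\<close>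
  edges labelled 0 and at most \<open>M\<close> edges for each of the \<open>N\<close> rows. The
  accepting set is cut down to residues below \<open>p\<close>, as well-formedness demands;
  acceptance is unchanged because \<open>W N mod p\<close> is such a residue.\<close>

lemma linear_gate:
  assumes "prime p"
    and lt: "\<And>i u b. \<lbrakk>1 \<le> i; i \<le> N; (u, b) \<in> set (R i)\<rbrakk> \<Longrightarrow> u < i \<and> b < s"
    and len: "\<And>i. \<lbrakk>1 \<le> i; i \<le> N\<rbrakk> \<Longrightarrow> length (R i) \<le> M"
  obtains g where "gate_wf p s g" and "gate_size g \<le> s + 2 * N + 1 + N * M"
    and "\<And>y W :: nat \<Rightarrow> nat. \<lbrakk>length y = s; [W 0 = 1] (mod p);
        \<And>i. \<lbrakk>1 \<le> i; i \<le> N\<rbrakk> \<Longrightarrow> [W i = (\<Sum>(u, b)\<leftarrow>R i. if y ! b then W u else 0)] (mod p)\<rbrakk>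
      \<Longrightarrow> gate_out p y g \<longleftrightarrow> W N mod p \<in> T"
proof
  let ?E = "lin_edges N R"
  let ?g = "([0..<s], (Suc N, ?E), int ` (T \<inter> {..<p}))"
  have p: "p > 1" using assms(1) prime_gt_1_nat by blast
  have inc: "\<forall>e\<in>set ?E. fst e < fst (snd e)"
    by (rule lin_edges_increasing) (use lt in blast)
  have zero_edge: "(v, Suc v, AConst 0) \<in> set ?E" if "v < N" for v
    using that by (auto simp: lin_edges_def)
  have incoming: "\<exists>(u, w, l)\<in>set ?E. w = v" if "0 < v \<and> v < Suc N" for v
    using zero_edge[of "v - 1"] that by force
  have outgoing: "\<exists>(u, w, l)\<in>set ?E. u = v" if "v < Suc N - 1" for v
    using zero_edge[of v] that by force
  have edge: "fst e < fst (snd e) \<and> fst (snd e) < Suc N \<and>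
      (case snd (snd e) of AVar j \<Rightarrow> j < s | AConst c \<Rightarrow> c < p)" if "e \<in> set ?E" for e
  proof -
    have "fst e < fst (snd e)" using inc that by blast
    moreover have "fst (snd e) < Suc N \<and> (case snd (snd e) of AVar j \<Rightarrow> j < s | AConst c \<Rightarrow> c < p)"
      using that lt p by (fastforce simp: lin_edges_def)
    ultimately show ?thesis by blast
  qed
  have "abp_wf p s (Suc N, ?E)"
    unfolding abp_wf_def prod.case
    by (intro conjI allI impI ballI incoming outgoing) (use edge in \<open>auto split: prod.splits\<close>)
  then show "gate_wf p s ?g" by (auto simp: gate_wf_def)
  show "gate_size ?g \<le> s + 2 * N + 1 + N * M"
    using length_lin_edges[of N R M] len by (simp add: gate_size_def abp_size_def)
  fix y and W :: "nat \<Rightarrow> nat"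
  assume y: "length y = s" and W: "[W 0 = 1] (mod p)"
    "\<And>i. \<lbrakk>1 \<le> i; i \<le> N\<rbrakk> \<Longrightarrow> [W i = (\<Sum>(u, b)\<leftarrow>R i. if y ! b then W u else 0)] (mod p)"
  have "[path_sum ?E y (N - N) N = int (W N)] (mod int p)"
    using W by (intro path_sum_lin_edges) (use lt in blast)+
  then have "path_sum ?E y 0 N mod int p = int (W N mod p)"
    by (simp add: cong_def zmod_int)
  moreover have "map ((!) y) [0..<s] = y" using y map_nth by blast
  ultimately have "abp_val p (Suc N, ?E) (map ((!) y) [0..<s]) = int (W N mod p)"
    by (simp add: abp_val_def path_sum_def)
  then show "gate_out p y ?g \<longleftrightarrow> W N mod p \<in> T"
    using p by (auto simp: gate_out_def)
qed

section \<open>Layers of gates, described by the Boolean functions they compute\<close>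

text \<open>The layers themselves are hidden: what remains is the list of functions at the top and a
  size bound. An empty \<open>ps\<close> is allowed and stands for the bare inputs, so that layers
  can be added one at a time.\<close>

definition computable :: "nat list \<Rightarrow> nat \<Rightarrow> nat \<Rightarrow> (bool list \<Rightarrow> bool) list \<Rightarrow> bool" where
  "computable ps n Z F \<longleftrightarrow> (\<exists>Ls. layers_wf n ps Ls \<and> layers_size Ls \<le> Z \<and>
     (\<forall>x. length x = n \<longrightarrow> layers_eval ps Ls x = map (\<lambda>f. f x) F))"

lemma computable_inputs: "computable [] n 0 (map (\<lambda>q x. x ! q) [0..<n])"
proof -
  have "layers_eval [] [] x = map (\<lambda>f. f x) (map (\<lambda>q x. x ! q) [0..<n])" if "length x = n" for x
    using that map_nth[of x] by (simp add: comp_def)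
  then show ?thesis
    unfolding computable_def by (intro exI[of _ "[]"]) (simp add: layers_size_def)
qed

text \<open>A linear program modulo \<open>p\<close> in the variables \<open>W x 0, W x 1, \<dots>\<close>, with bits of \<open>F\<close> as coefficients;
  repeating an entry of a row yields other coefficients.\<close>

definition linear_bit ::
  "nat \<Rightarrow> nat \<Rightarrow> (bool list \<Rightarrow> bool) list \<Rightarrow> nat \<Rightarrow> nat \<Rightarrow> (bool list \<Rightarrow> bool) \<Rightarrow> bool" where
  "linear_bit p n F N M g \<longleftrightarrow> (\<exists>k R (W :: bool list \<Rightarrow> nat \<Rightarrow> nat) T. k \<le> N \<and>
     (\<forall>i. 1 \<le> i \<and> i \<le> k \<longrightarrow> length (R i) \<le> M \<and> (\<forall>(u, f)\<in>set (R i). u < i \<and> f \<in> set F)) \<and>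
     (\<forall>x. length x = n \<longrightarrow> [W x 0 = 1] (mod p) \<and>
        (\<forall>i. 1 \<le> i \<and> i \<le> k \<longrightarrow> [W x i = (\<Sum>(u, f)\<leftarrow>R i. if f x then W x u else 0)] (mod p)) \<and>
        (g x \<longleftrightarrow> W x k mod p \<in> T)))"

lemma linear_bitI:
  fixes W :: "bool list \<Rightarrow> nat \<Rightarrow> nat"
  assumes "k \<le> N"
    and "\<And>i. \<lbrakk>1 \<le> i; i \<le> k\<rbrakk> \<Longrightarrow> length (R i) \<le> M"
    and "\<And>i u f. \<lbrakk>1 \<le> i; i \<le> k; (u, f) \<in> set (R i)\<rbrakk> \<Longrightarrow> u < i \<and> f \<in> set F"
    and "\<And>x. length x = n \<Longrightarrow> [W x 0 = 1] (mod p)"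
    and "\<And>x i. \<lbrakk>length x = n; 1 \<le> i; i \<le> k\<rbrakk>
      \<Longrightarrow> [W x i = (\<Sum>(u, f)\<leftarrow>R i. if f x then W x u else 0)] (mod p)"
    and "\<And>x. length x = n \<Longrightarrow> g x \<longleftrightarrow> W x k mod p \<in> T"
  shows "linear_bit p n F N M g"
proof -
  have "\<forall>i. 1 \<le> i \<and> i \<le> k \<longrightarrow> length (R i) \<le> M \<and> (\<forall>(u, f)\<in>set (R i). u < i \<and> f \<in> set F)"
    using assms(2,3) by blast
  moreover have "\<forall>x. length x = n \<longrightarrow> [W x 0 = 1] (mod p) \<and>
      (\<forall>i. 1 \<le> i \<and> i \<le> k \<longrightarrow> [W x i = (\<Sum>(u, f)\<leftarrow>R i. if f x then W x u else 0)] (mod p)) \<and>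
      (g x \<longleftrightarrow> W x k mod p \<in> T)"
    using assms(4-6) by blast
  ultimately show ?thesis
    unfolding linear_bit_def using assms(1) by (intro exI conjI)
qed

lemma linear_bit_gate:
  assumes "prime p" and "linear_bit p n F N M g"
  obtains G where "gate_wf p (length F) G" and "gate_size G \<le> length F + 2 * N + 1 + N * M"
    and "\<And>x. length x = n \<Longrightarrow> gate_out p (map (\<lambda>f. f x) F) G \<longleftrightarrow> g x"
proof -
  obtain k R and W :: "bool list \<Rightarrow> nat \<Rightarrow> nat" and T where k: "k \<le> N"
    and R': "\<forall>i. 1 \<le> i \<and> i \<le> k \<longrightarrow> length (R i) \<le> M \<and> (\<forall>(u, f)\<in>set (R i). u < i \<and> f \<in> set F)"
    and W': "\<forall>x. length x = n \<longrightarrow> [W x 0 = 1] (mod p) \<and>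
        (\<forall>i. 1 \<le> i \<and> i \<le> k \<longrightarrow> [W x i = (\<Sum>(u, f)\<leftarrow>R i. if f x then W x u else 0)] (mod p)) \<and>
        (g x \<longleftrightarrow> W x k mod p \<in> T)"
    using assms(2) unfolding linear_bit_def by (elim exE conjE) (rule that)
  have R: "length (R i) \<le> M \<and> (\<forall>(u, f)\<in>set (R i). u < i \<and> f \<in> set F)" if "1 \<le> i" "i \<le> k" for i
    using R' that by blast
  have W: "[W x 0 = 1] (mod p)"
      "\<lbrakk>1 \<le> i; i \<le> k\<rbrakk> \<Longrightarrow> [W x i = (\<Sum>(u, f)\<leftarrow>R i. if f x then W x u else 0)] (mod p)"
      "g x \<longleftrightarrow> W x k mod p \<in> T" if "length x = n" for x i
    using W' that by simp_all
  \<comment> \<open>Rows name bits by functions, edge labels by positions. If a function occurs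
    several times in \<open>F\<close>, any of its positions serves.\<close>
  define idx where "idx f = (SOME b. b < length F \<and> F ! b = f)" for f
  have idx: "idx f < length F \<and> F ! idx f = f" if "f \<in> set F" for f
    unfolding idx_def by (rule someI_ex) (use that in \<open>auto simp: in_set_conv_nth\<close>)
  define R2 where "R2 i = map (\<lambda>(u, f). (u, idx f)) (R i)" for i
  have lt: "u < i \<and> b < length F" if "1 \<le> i" "i \<le> k" "(u, b) \<in> set (R2 i)" for i u b
    using that R[of i] idx by (fastforce simp: R2_def)
  have len: "length (R2 i) \<le> M" if "1 \<le> i" "i \<le> k" for i
    using that R[of i] by (simp add: R2_def)
  obtain G where G: "gate_wf p (length F) G" "gate_size G \<le> length F + 2 * k + 1 + k * M"
    "\<And>y W :: nat \<Rightarrow> nat. \<lbrakk>length y = length F; [W 0 = 1] (mod p);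
        \<And>i. \<lbrakk>1 \<le> i; i \<le> k\<rbrakk> \<Longrightarrow> [W i = (\<Sum>(u, b)\<leftarrow>R2 i. if y ! b then W u else 0)] (mod p)\<rbrakk>
      \<Longrightarrow> gate_out p y G \<longleftrightarrow> W k mod p \<in> T"
    by (rule linear_gate[OF assms(1), where N = k and R = R2 and s = "length F" and M = M and T = T])
      (use lt len in blast)+
  show thesis
  proof
    show "gate_wf p (length F) G" by (fact G(1))
    have "k * M \<le> N * M" using k by simp
    then show "gate_size G \<le> length F + 2 * N + 1 + N * M" using G(2) k by linarith
    fix x :: "bool list" assume x: "length x = n"
    have "[W x i = (\<Sum>(u, b)\<leftarrow>R2 i. if map (\<lambda>f. f x) F ! b then W x u else 0)] (mod p)"
      if "1 \<le> i" "i \<le> k" for i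
    proof -
      have "(\<Sum>(u, b)\<leftarrow>R2 i. if map (\<lambda>f. f x) F ! b then W x u else 0) =
          (\<Sum>(u, f)\<leftarrow>R i. if f x then W x u else 0)"
        unfolding R2_def map_map
        by (rule arg_cong[of _ _ sum_list], rule map_cong) (use that R[of i] idx in auto)
      then show ?thesis using W(2)[OF x that] by simp
    qed
    then show "gate_out p (map (\<lambda>f. f x) F) G \<longleftrightarrow> g x"
      using G(3)[of "map (\<lambda>f. f x) F" "W x"] W(1)[OF x] W(3)[OF x] by simp
  qed
qed

lemma computable_layer:
  assumes "prime p" and "computable ps n Z F" and "\<And>g. g \<in> set G \<Longrightarrow> linear_bit p n F N M g"
  shows "computable (p # ps) n (Z + length G * (length F + 2 * N + 1 + N * M)) G"
proof -
  obtain Ls where Ls: "layers_wf n ps Ls" "layers_size Ls \<le> Z"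
    "\<And>x. length x = n \<Longrightarrow> layers_eval ps Ls x = map (\<lambda>f. f x) F"
    using assms(2) unfolding computable_def by blast
  have "\<forall>g\<in>set G. \<exists>h. gate_wf p (length F) h \<and> gate_size h \<le> length F + 2 * N + 1 + N * M \<and>
      (\<forall>x. length x = n \<longrightarrow> gate_out p (map (\<lambda>f. f x) F) h \<longleftrightarrow> g x)"
  proof
    fix g assume "g \<in> set G"
    show "\<exists>h. gate_wf p (length F) h \<and> gate_size h \<le> length F + 2 * N + 1 + N * M \<and>
      (\<forall>x. length x = n \<longrightarrow> gate_out p (map (\<lambda>f. f x) F) h \<longleftrightarrow> g x)"
      by (rule linear_bit_gate[OF assms(1) assms(3)[OF \<open>g \<in> set G\<close>]]) blast
  qed
  then obtain h where h: "\<And>g. g \<in> set G \<Longrightarrow> gate_wf p (length F) (h g)"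
    "\<And>g. g \<in> set G \<Longrightarrow> gate_size (h g) \<le> length F + 2 * N + 1 + N * M"
    "\<And>g x. \<lbrakk>g \<in> set G; length x = n\<rbrakk> \<Longrightarrow> gate_out p (map (\<lambda>f. f x) F) (h g) \<longleftrightarrow> g x"
    by metis
  \<comment> \<open>Evaluation on an arbitrary input of length \<open>n\<close> reveals the width of
    the layer below; for an empty stack it is \<open>n\<close>, the number of inputs.\<close>
  have width: "(if Ls = [] then n else length (hd Ls)) = length F"
  proof -
    have "length (layers_eval ps Ls (replicate n False)) = length F"
      using Ls(3)[of "replicate n False"] by simp
    then show ?thesis using Ls(1) by (cases ps; cases Ls) auto
  qed
  have "sum_list (map gate_size (map h G)) \<le> sum_list (map (\<lambda>g. length F + 2 * N + 1 + N * M) G)"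
    unfolding map_map by (rule sum_list_mono) (use h(2) in auto)
  then have "layers_size (map h G # Ls) \<le> Z + length G * (length F + 2 * N + 1 + N * M)"
    using Ls(2) by (simp add: layers_size_def sum_list_triv)
  moreover have "layers_wf n (p # ps) (map h G # Ls)"
    using width Ls(1) h(1) by simp
  moreover have "layers_eval (p # ps) (map h G # Ls) x = map (\<lambda>g. g x) G" if "length x = n" for x
    using that Ls(3) h(3) by simp
  ultimately show ?thesis unfolding computable_def by blast
qed

text \<open>A conjunction is a product: variable \<open>i\<close> is the product of the first
  \<open>i\<close> bits, so each row has a single entry, pointing to variable \<open>i - 1\<close>.
  Accepting the residue 1 is sound because \<open>p > 1\<close> keeps 0 and 1 apart.\<close>

lemma linear_bit_conj:
  assumes "p > 1" and "set fs \<subseteq> set F" and "length fs \<le> N" and "M \<ge> 1"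
    and "\<And>x. length x = n \<Longrightarrow> g x \<longleftrightarrow> (\<forall>f\<in>set fs. f x)"
  shows "linear_bit p n F N M g"
proof -
  let ?R = "\<lambda>i. [(i - 1, fs ! (i - 1))]"
  let ?W = "\<lambda>x i. if \<forall>j<i. (fs ! j) x then 1 else (0 :: nat)"
  show ?thesis
  proof (rule linear_bitI[where k = "length fs" and R = ?R and W = ?W and T = "{1}"])
    show "length fs \<le> N" by fact
    show "length (?R i) \<le> M" for i using \<open>M \<ge> 1\<close> by simp
    show "u < i \<and> f \<in> set F" if "1 \<le> i" "i \<le> length fs" "(u, f) \<in> set (?R i)" for i u f
    proof -
      have "f = fs ! (i - 1)" "u = i - 1" "i - 1 < length fs" using that by auto
      then show ?thesis using that(1) assms(2) nth_mem by fastforce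
    qed
    show "[?W x 0 = 1] (mod p)" for x by simp
    show "[?W x i = (\<Sum>(u, f)\<leftarrow>?R i. if f x then ?W x u else 0)] (mod p)"
      if "1 \<le> i" for i and x :: "bool list"
    proof (cases i)
      case (Suc k)
      have "(\<forall>j<Suc k. (fs ! j) x) \<longleftrightarrow> (fs ! k) x \<and> (\<forall>j<k. (fs ! j) x)"
        by (auto simp: less_Suc_eq)
      then show ?thesis using Suc by simp
    qed (use that in simp)
    show "g x \<longleftrightarrow> ?W x (length fs) mod p \<in> {1}" if "length x = n" for x
      using assms(1) assms(5)[OF that] by (simp add: all_set_conv_all_nth)
  qed
qed

text \<open>One row is enough: all its entries point to variable 0, so variable 1 is the number of
  true bits. This yields negations, by accepting the count 0 of a single bit, and disjunctions of
  mutually exclusive bits.\<close>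

lemma linear_bit_count:
  assumes "set fs \<subseteq> set F" and "length fs \<le> M" and "N \<ge> 1"
    and "\<And>x. length x = n \<Longrightarrow> g x \<longleftrightarrow> (\<Sum>f\<leftarrow>fs. of_bool (f x)) mod p \<in> T"
  shows "linear_bit p n F N M g"
proof -
  let ?R = "\<lambda>i::nat. map (\<lambda>f. (0::nat, f)) fs"
  let ?W = "\<lambda>x (i :: nat). if i = 0 then 1 else (\<Sum>f\<leftarrow>fs. of_bool (f x)) :: nat"
  show ?thesis
  proof (rule linear_bitI[where k = 1 and R = ?R and W = ?W and T = T])
    show "1 \<le> N" by fact
    show "length (?R i) \<le> M" for i using assms(2) by simp
    show "u < i \<and> f \<in> set F" if "1 \<le> i" "(u, f) \<in> set (?R i)" for i u f
      using that assms(1) by auto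
    show "[?W x 0 = 1] (mod p)" for x by simp
    show "[?W x i = (\<Sum>(u, f)\<leftarrow>?R i. if f x then ?W x u else 0)] (mod p)"
      if "1 \<le> i" for i and x :: "bool list"
      using that by (simp add: comp_def of_bool_def)
    show "g x \<longleftrightarrow> ?W x 1 mod p \<in> T" if "length x = n" for x
      using assms(4)[OF that] by simp
  qed
qed

subsection \<open>Characters of elementary abelian groups\<close>

lemma (in group) nat_pow_cong:
  assumes "z \<in> carrier G" and "z [^] p = \<one>" and "[a = b] (mod p)"
  shows "z [^] a = z [^] (b :: nat)"
proof -
  have "z [^] c = z [^] (c mod p)" for c
  proof -
    have "z [^] c = z [^] (p * (c div p) + c mod p)" by simp
    also have "\<dots> = z [^] (c mod p)"
      using assms(1,2) by (simp only: nat_pow_mult[symmetric] nat_pow_pow[symmetric] nat_pow_one) simp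
    finally show ?thesis .
  qed
  then show ?thesis using assms(3) by (metis cong_def)
qed

lemma (in group) finite_imp_pow_eq_one:
  assumes "finite (carrier G)" and z: "z \<in> carrier G"
  obtains n :: nat where "n > 0" and "z [^] n = \<one>"
proof -
  have "range (\<lambda>n :: nat. z [^] n) \<subseteq> carrier G" using z by auto
  then have "\<not> inj (\<lambda>n :: nat. z [^] n)"
    using assms(1) by (meson finite_imageD finite_subset infinite_UNIV_nat)
  then obtain i j :: nat where ij: "i < j" "z [^] i = z [^] j"
    unfolding inj_on_def by (metis nat_neq_iff)
  have "z [^] i \<otimes> z [^] (j - i) = z [^] j" using ij(1) z by (simp add: nat_pow_mult)
  then have "z [^] (j - i) = \<one>" using z by (simp add: ij(2)[symmetric])
  with ij(1) show thesis by (intro that[of "j - i"]) auto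
qed

text \<open>Take a subgroup \<open>H\<close> maximal among those avoiding \<open>x\<close>. Then \<open>G\<close> is the direct sum of \<open>H\<close> and
  the cyclic group generated by \<open>x\<close>, and the character is the coordinate along \<open>x\<close>.\<close>

lemma (in comm_group) exists_character:
  assumes fin: "finite (carrier G)" and p: "prime (p :: nat)"
    and tors: "\<And>g. g \<in> carrier G \<Longrightarrow> g [^] p = \<one>"
    and x: "x \<in> carrier G" "x \<noteq> \<one>"
  obtains \<chi> :: "'a \<Rightarrow> nat"
  where "\<And>g h. \<lbrakk>g \<in> carrier G; h \<in> carrier G\<rbrakk> \<Longrightarrow> [\<chi> (g \<otimes> h) = \<chi> g + \<chi> h] (mod p)"
    and "\<not> [\<chi> x = 0] (mod p)"
proof -
  let ?A = "{H. subgroup H G \<and> x \<notin> H}"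
  have "?A \<subseteq> Pow (carrier G)" using subgroup.subset by blast
  then have "finite ?A" using fin by (meson finite_Pow_iff finite_subset)
  moreover have "{\<one>} \<in> ?A" using x triv_subgroup by simp
  ultimately obtain H where H: "subgroup H G" "x \<notin> H"
    and max: "\<And>K. \<lbrakk>subgroup K G; x \<notin> K; H \<subseteq> K\<rbrakk> \<Longrightarrow> H = K"
    using finite_has_maximal[of ?A] by blast
  interpret H: subgroup H G by fact
  have H_pow: "h [^] (n :: nat) \<in> H" if "h \<in> H" for h n
    using that by (induction n) auto
  have inv_mod: "\<exists>l. [k * l = 1] (mod p)" if "\<not> p dvd k" for k
    using cong_solve_coprime_nat[of k p] that p prime_imp_coprime[of p k]
    by (auto simp: coprime_commute)
  have pow_inverse: "(z [^] k) [^] l = z" if "z \<in> carrier G" "[k * l = 1] (mod p)" for z and k l :: nat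
    using nat_pow_cong[OF that(1) tors[OF that(1)] that(2)] that(1) by (simp add: nat_pow_pow)
  have decomp: "\<exists>l :: nat. \<exists>h\<in>H. z = h \<otimes> x [^] l" if z: "z \<in> carrier G" for z
  proof (cases "z \<in> H")
    case True
    then have "z = z \<otimes> x [^] (0 :: nat)" using z by simp
    with True show ?thesis by blast
  next
    case False
    \<comment> \<open>The subgroup generated by \<open>H\<close> and \<open>z\<close>. It properly
      contains \<open>H\<close>, so by maximality it contains \<open>x\<close>. In the resulting
      relation \<open>x = h \<otimes> z [^] k\<close> the exponent is prime to \<open>p\<close>, as
      otherwise \<open>x = h\<close> would lie in \<open>H\<close>; hence the relation can be solved
      for \<open>z\<close>.\<close>
    let ?K = "{h \<otimes> z [^] (k :: nat) | h k. h \<in> H}"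
    have "subgroup ?K G"
    proof (rule subgroupI)
      show "?K \<subseteq> carrier G" using z by auto
      show "?K \<noteq> {}" using H.one_closed by blast
    next
      fix u assume "u \<in> ?K"
      then obtain h and k :: nat where u: "u = h \<otimes> z [^] k" "h \<in> H" by blast
      have "z [^] k \<otimes> z [^] ((p - 1) * k) = z [^] (p * k)"
        using p prime_gt_0_nat[OF p] by (cases p) (auto simp: nat_pow_mult z)
      also have "\<dots> = \<one>" using tors[OF z] z by (metis nat_pow_one nat_pow_pow)
      finally have "inv (z [^] k) = z [^] ((p - 1) * k)"
        using z by (metis inv_equality m_comm nat_pow_closed)
      then have "inv u = inv h \<otimes> z [^] ((p - 1) * k)"
        using u z by (simp add: inv_mult)
      then show "inv u \<in> ?K" using u(2) H.m_inv_closed by blast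
    next
      fix u v assume "u \<in> ?K" "v \<in> ?K"
      then obtain h h' and k k' :: nat
        where "u = h \<otimes> z [^] k" "h \<in> H" "v = h' \<otimes> z [^] k'" "h' \<in> H" by blast
      then have "u \<otimes> v = (h \<otimes> h') \<otimes> z [^] (k + k')" "h \<otimes> h' \<in> H"
        using z by (auto simp: nat_pow_mult[symmetric] m_ac)
      then show "u \<otimes> v \<in> ?K" by blast
    qed
    moreover have "H \<subseteq> ?K"
    proof
      fix h assume "h \<in> H"
      then have "h = h \<otimes> z [^] (0 :: nat)" by simp
      with \<open>h \<in> H\<close> show "h \<in> ?K" by blast
    qed
    moreover have "z \<in> ?K"
    proof -
      have "z = \<one> \<otimes> z [^] (1 :: nat)" using z by simp
      then show ?thesis using H.one_closed by blast
    qed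
    ultimately have "x \<in> ?K" using max False by blast
    then obtain h and k :: nat where xk: "x = h \<otimes> z [^] k" "h \<in> H" by blast
    have "\<not> p dvd k"
    proof
      assume "p dvd k"
      then have "z [^] k = z [^] (0 :: nat)"
        using z tors[OF z] by (intro nat_pow_cong[of _ p]) (auto simp: cong_0_iff)
      with xk have "x = h" by simp
      with xk H show False by simp
    qed
    then obtain l where l: "[k * l = 1] (mod p)" using inv_mod by blast
    have "x [^] l = h [^] l \<otimes> z"
      using xk z pow_inverse[OF z l] by (simp add: nat_pow_distrib)
    then have "z = inv (h [^] l) \<otimes> x [^] l"
      using xk z x(1) by (metis H.mem_carrier inv_solve_left' nat_pow_closed m_closed)
    moreover have "inv (h [^] l) \<in> H" using H_pow xk by simp
    ultimately show ?thesis by blast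
  qed
  \<comment> \<open>The coordinate along \<open>x\<close> is well defined modulo \<open>p\<close>:
    two expressions with incongruent exponents would put into \<open>H\<close> a power of
    \<open>x\<close> whose exponent is invertible modulo \<open>p\<close>, and with it
    \<open>x\<close>.\<close>
  have unique_le: "[a = b] (mod p)"
    if eq: "h \<otimes> x [^] a = h' \<otimes> x [^] b" "h \<in> H" "h' \<in> H" and le: "a \<le> b" for a b :: nat and h h'
  proof (rule ccontr)
    assume "\<not> [a = b] (mod p)"
    then have "\<not> p dvd b - a"
      using le by (metis cong_altdef_nat cong_sym)
    then obtain l where l: "[(b - a) * l = 1] (mod p)" using inv_mod by blast
    have "h \<otimes> x [^] a = h' \<otimes> (x [^] (b - a) \<otimes> x [^] a)"
      using eq le x(1) by (simp add: nat_pow_mult)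
    then have "h = h' \<otimes> x [^] (b - a)"
      using eq(2,3) x(1) by (simp add: m_assoc[symmetric])
    then have "x [^] (b - a) = inv h' \<otimes> h"
      using eq(2,3) x(1) by (metis H.mem_carrier inv_solve_left nat_pow_closed)
    then have "x [^] (b - a) \<in> H" using eq(2,3) by simp
    then have "(x [^] (b - a)) [^] l \<in> H" by (rule H_pow)
    then show False using pow_inverse[OF x(1) l] H(2) by simp
  qed
  have unique: "[a = b] (mod p)"
    if "h \<otimes> x [^] a = h' \<otimes> x [^] b" "h \<in> H" "h' \<in> H" for a b :: nat and h h'
    using unique_le[of h a h' b] unique_le[of h' b h a] that
    by (metis cong_sym nat_le_linear)
  define \<chi> where "\<chi> z = (SOME l :: nat. \<exists>h\<in>H. z = h \<otimes> x [^] l)" for z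
  have \<chi>: "\<exists>h\<in>H. z = h \<otimes> x [^] \<chi> z" if "z \<in> carrier G" for z
    unfolding \<chi>_def by (rule someI_ex) (rule decomp[OF that])
  show thesis
  proof
    fix g h assume gh: "g \<in> carrier G" "h \<in> carrier G"
    obtain u v w where "u \<in> H" "g = u \<otimes> x [^] \<chi> g" "v \<in> H" "h = v \<otimes> x [^] \<chi> h"
      "w \<in> H" "g \<otimes> h = w \<otimes> x [^] \<chi> (g \<otimes> h)"
      using \<chi> gh by (meson m_closed)
    moreover from this have "w \<otimes> x [^] \<chi> (g \<otimes> h) = (u \<otimes> v) \<otimes> x [^] (\<chi> g + \<chi> h)"
      by (metis (no_types, lifting) H.mem_carrier m_assoc m_lcomm nat_pow_closed nat_pow_mult x(1) m_closed)
    ultimately show "[\<chi> (g \<otimes> h) = \<chi> g + \<chi> h] (mod p)"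
      using unique[of w _ "u \<otimes> v"] by blast
  next
    obtain h where h: "h \<in> H" "x = h \<otimes> x [^] \<chi> x" using \<chi> x by blast
    have "\<one> \<otimes> x [^] (1 :: nat) = h \<otimes> x [^] \<chi> x"
      using x(1) by (simp add: h(2)[symmetric])
    then have "[1 = \<chi> x] (mod p)" by (rule unique) (use h(1) in auto)
    then show "\<not> [\<chi> x = 0] (mod p)"
      using prime_gt_1_nat[OF p] by (auto simp: cong_def)
  qed
qed

subsection \<open>Abelian congruence intervals of Malcev algebras\<close>

fun tsubst :: "('v \<Rightarrow> 'w trm) \<Rightarrow> 'v trm \<Rightarrow> 'w trm" where
  "tsubst \<sigma> (TVar v) = \<sigma> v"
| "tsubst \<sigma> (TOp k ts) = TOp k (map (tsubst \<sigma>) ts)"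

lemma teval_tsubst: "teval ops env (tsubst \<sigma> t) = teval ops (\<lambda>v. teval ops env (\<sigma> v)) t"
  by (induction t) (auto simp: comp_def cong: map_cong)

lemma twf_tsubst: "\<lbrakk>twf ops t; \<And>v. twf ops (\<sigma> v)\<rbrakk> \<Longrightarrow> twf ops (tsubst \<sigma> t)"
  by (induction t) auto

lemma teval_closed:
  assumes "finite_algebra A ops" and "twf ops t" and "\<And>v. env v \<in> A"
  shows "teval ops env t \<in> A"
  using assms(2)
proof (induction t)
  case (TOp k ts)
  then have "set (map (teval ops env) ts) \<subseteq> A" by auto
  then show ?case using TOp.prems assms(1) by (simp add: finite_algebra_def)
qed (use assms in simp)

definition compatible :: "'a ops \<Rightarrow> 'a rel \<Rightarrow> bool" where
  "compatible ops \<theta> \<longleftrightarrow> (\<forall>k < length ops. \<forall>xs ys. length xs = fst (ops ! k) \<and> length ys = length xs \<and>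
     (\<forall>i < length xs. (xs ! i, ys ! i) \<in> \<theta>) \<longrightarrow> (snd (ops ! k) xs, snd (ops ! k) ys) \<in> \<theta>)"

lemma is_cong_iff: "is_cong A ops \<theta> \<longleftrightarrow> equiv A \<theta> \<and> compatible ops \<theta>"
  by (simp add: is_cong_def compatible_def)

lemma teval_compatible:
  assumes "compatible ops \<theta>" and "twf ops t" and "\<And>v. (e v, e' v) \<in> \<theta>"
  shows "(teval ops e t, teval ops e' t) \<in> \<theta>"
  using assms(2)
proof (induction t)
  case (TOp k ts)
  then show ?case using assms(1) by (simp add: compatible_def)
qed (use assms in simp)

locale malcev_algebra =
  fixes A :: "'a set" and ops :: "'a ops" and d :: "nat trm"
  assumes alg: "finite_algebra A ops" and wf_d: "twf ops d"
    and malcev: "\<lbrakk>x \<in> A; y \<in> A\<rbrakk> \<Longrightarrow> teval ops (\<lambda>i. if i = 0 then x else y) d = x"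
      "\<lbrakk>x \<in> A; y \<in> A\<rbrakk> \<Longrightarrow> teval ops (\<lambda>i. if i = 2 then x else y) d = x"
begin

definition m :: "'a \<Rightarrow> 'a \<Rightarrow> 'a \<Rightarrow> 'a" where
  "m x y z = teval ops (\<lambda>i. if i = 0 then x else if i = 2 then z else y) d"

definition m_trm :: "'v trm \<Rightarrow> 'v trm \<Rightarrow> 'v trm \<Rightarrow> 'v trm" where
  "m_trm r s t = tsubst (\<lambda>i. if i = 0 then r else if i = 2 then t else s) d"

lemma teval_m_trm: "teval ops e (m_trm r s t) = m (teval ops e r) (teval ops e s) (teval ops e t)"
  unfolding m_trm_def m_def teval_tsubst by (rule arg_cong[of _ _ "\<lambda>e. teval ops e d"]) auto

lemma twf_m_trm: "\<lbrakk>twf ops r; twf ops s; twf ops t\<rbrakk> \<Longrightarrow> twf ops (m_trm r s t)"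
  unfolding m_trm_def by (rule twf_tsubst) (auto simp: wf_d)

lemma m_closed [simp]: "\<lbrakk>x \<in> A; y \<in> A; z \<in> A\<rbrakk> \<Longrightarrow> m x y z \<in> A"
  unfolding m_def by (rule teval_closed[OF alg wf_d]) auto

lemma m_right [simp]: "\<lbrakk>x \<in> A; y \<in> A\<rbrakk> \<Longrightarrow> m x y y = x"
  using malcev(1)[of x y] by (simp add: m_def cong: if_cong)

lemma m_left [simp]: "\<lbrakk>x \<in> A; y \<in> A\<rbrakk> \<Longrightarrow> m y y x = x"
proof -
  assume "x \<in> A" "y \<in> A"
  moreover have "(\<lambda>i. if i = 0 then y else if i = 2 then x else y) = (\<lambda>i :: nat. if i = 2 then x else y)"
    by auto
  ultimately show ?thesis using malcev(2)[of x y] by (simp add: m_def)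
qed

lemma op_closed: "\<lbrakk>k < length ops; length xs = fst (ops ! k); set xs \<subseteq> A\<rbrakk> \<Longrightarrow> snd (ops ! k) xs \<in> A"
  using alg by (simp add: finite_algebra_def)

lemma finite_A: "finite A" and A_nonempty: "A \<noteq> {}"
  using alg by (auto simp: finite_algebra_def)

lemma m_compatible:
  "\<lbrakk>compatible ops \<theta>; (x, x') \<in> \<theta>; (y, y') \<in> \<theta>; (z, z') \<in> \<theta>\<rbrakk> \<Longrightarrow> (m x y z, m x' y' z') \<in> \<theta>"
  unfolding m_def by (rule teval_compatible[OF _ wf_d]) auto

lemma m_cong: "\<lbrakk>is_cong A ops \<theta>; (x, x') \<in> \<theta>; (y, y') \<in> \<theta>; (z, z') \<in> \<theta>\<rbrakk> \<Longrightarrow> (m x y z, m x' y' z') \<in> \<theta>"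
  by (simp add: is_cong_iff m_compatible)

text \<open>Malcev's argument. Applying \<open>m\<close> to the pairs \<open>(a, a)\<close>,
  \<open>(a, b)\<close>, \<open>(b, b)\<close> gives \<open>(b, a)\<close>; applying it to
  \<open>(a, b)\<close>, \<open>(b, b)\<close>, \<open>(b, c)\<close> gives \<open>(a, c)\<close>.
  Later constructions of congruences therefore only have to establish reflexivity and
  compatibility.\<close>

lemma reflexive_compatible_is_cong:
  assumes sub: "\<theta> \<subseteq> A \<times> A" and refl: "\<And>a. a \<in> A \<Longrightarrow> (a, a) \<in> \<theta>" and comp: "compatible ops \<theta>"
  shows "is_cong A ops \<theta>"
proof -
  have "(b, a) \<in> \<theta>" if "(a, b) \<in> \<theta>" for a b
    using m_compatible[OF comp, of a a a b b b] that sub refl by auto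
  then have "sym \<theta>" by (auto intro: symI)
  moreover have "(a, c) \<in> \<theta>" if "(a, b) \<in> \<theta>" "(b, c) \<in> \<theta>" for a b c
  proof -
    have "a \<in> A" "b \<in> A" "c \<in> A" using that sub by auto
    then show ?thesis using m_compatible[OF comp that(1) refl[of b] that(2)] by simp
  qed
  then have "trans \<theta>" by (auto intro: transI)
  moreover have "refl_on A \<theta>" using refl by (auto simp: refl_on_def dest: subsetD[OF sub])
  ultimately show ?thesis using comp sub by (auto simp: is_cong_iff equiv_def)
qed

text \<open>Modulo \<gamma>, every term operation preserves \<open>x - y + z\<close> on
  \<delta>-blocks. The tuples are related coordinatewise only, so different variables may range over
  different blocks. For basic operations this is affinity; for the term \<open>d\<close> it makes
  the blocks abelian groups.\<close>

definition abelian_over :: "'a rel \<Rightarrow> 'a rel \<Rightarrow> bool" where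
  "abelian_over \<delta> \<gamma> \<longleftrightarrow> (\<forall>t :: nat trm. twf ops t \<longrightarrow>
     (\<forall>x y z. (\<forall>i. (x i, y i) \<in> \<delta> \<and> (y i, z i) \<in> \<delta>) \<longrightarrow>
       (teval ops (\<lambda>i. m (x i) (y i) (z i)) t, m (teval ops x t) (teval ops y t) (teval ops z t)) \<in> \<gamma>))"

lemma abelian_over_mono: "\<lbrakk>abelian_over \<delta> \<gamma>; \<delta>' \<subseteq> \<delta>; \<gamma> \<subseteq> \<gamma>'\<rbrakk> \<Longrightarrow> abelian_over \<delta>' \<gamma>'"
  unfolding abelian_over_def by (meson subsetD)

lemma is_cong_refl: "\<lbrakk>is_cong A ops \<theta>; a \<in> A\<rbrakk> \<Longrightarrow> (a, a) \<in> \<theta>"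
  and is_cong_sym: "\<lbrakk>is_cong A ops \<theta>; (a, b) \<in> \<theta>\<rbrakk> \<Longrightarrow> (b, a) \<in> \<theta>"
  and is_cong_trans: "\<lbrakk>is_cong A ops \<theta>; (a, b) \<in> \<theta>; (b, c) \<in> \<theta>\<rbrakk> \<Longrightarrow> (a, c) \<in> \<theta>"
  and is_cong_carrier: "\<lbrakk>is_cong A ops \<theta>; (a, b) \<in> \<theta>\<rbrakk> \<Longrightarrow> a \<in> A \<and> b \<in> A"
  unfolding is_cong_def equiv_def by (auto dest: refl_onD symD transD)

text \<open>Apply the term condition to \<open>H(x, y, z, w) = m (t (m x y z)) (m (t x) (t y) (t z)) w\<close>: as
  \<open>H(y, y, y, w) = w = H(y, y, z, w)\<close>, also \<open>w = H(x, y, y, w)\<close> and \<open>H(x, y, z, w)\<close> are congruent.\<close>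

lemma centralizes_imp_abelian_over:
  assumes \<delta>: "is_cong A ops \<delta>" and \<gamma>: "is_cong A ops \<gamma>" and c: "centralizes ops \<delta> \<delta> \<gamma>"
  shows "abelian_over \<delta> \<gamma>"
  unfolding abelian_over_def
proof (intro allI impI)
  fix t :: "nat trm" and x y z :: "nat \<Rightarrow> 'a" assume t: "twf ops t"
    and rel: "\<forall>i. (x i, y i) \<in> \<delta> \<and> (y i, z i) \<in> \<delta>"
  have A: "x i \<in> A" "y i \<in> A" "z i \<in> A" for i
    using rel is_cong_carrier[OF \<delta>] by blast+
  let ?x = "\<lambda>i. TVar (Inl i) :: (nat + nat) trm"
  let ?y = "\<lambda>i. TVar (Inr (3 * i)) :: (nat + nat) trm"
  let ?z = "\<lambda>i. TVar (Inr (3 * i + 1)) :: (nat + nat) trm"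
  let ?H = "m_trm (tsubst (\<lambda>i. m_trm (?x i) (?y i) (?z i)) t)
    (m_trm (tsubst ?x t) (tsubst ?y t) (tsubst ?z t)) (TVar (Inr 2))"
  have H: "twf ops ?H" by (intro twf_m_trm twf_tsubst t) auto
  let ?T = "\<lambda>e. teval ops e t"
  define w where "w = m (?T x) (?T y) (?T z)"
  have T: "?T x \<in> A" "?T y \<in> A" "?T z \<in> A" "?T (\<lambda>i. m (x i) (y i) (z i)) \<in> A"
    by (intro teval_closed[OF alg t] m_closed A)+
  then have w: "w \<in> A" by (simp add: w_def)
  \<comment> \<open>The \<open>Inr\<close> variables are shared out by residue modulo 3: residue 0
    holds the fixed \<open>y\<close>, residue 1 the argument that moves from \<open>y\<close> to
    \<open>z\<close>, and residue 2, used only through variable 2, the constant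
    \<open>w\<close>.\<close>
  define g where "g u j = (if j mod 3 = 0 then y (j div 3) else if j mod 3 = 1 then u (j div 3) else w)"
    for u and j :: nat
  have g: "g u (3 * i) = y i" "g u (Suc (3 * i)) = u i" "g u 2 = w" for u i
  proof -
    have "Suc (3 * i) div 3 = i" "Suc (3 * i) mod 3 = 1" by presburger+
    then show "g u (3 * i) = y i" "g u (Suc (3 * i)) = u i" "g u 2 = w" by (simp_all add: g_def)
  qed
  have eval: "teval ops (case_sum s (g u)) ?H =
      m (?T (\<lambda>i. m (s i) (y i) (u i))) (m (?T s) (?T y) (?T u)) w" for s u
    by (simp add: teval_m_trm teval_tsubst g)
  have "(g y j, g z j) \<in> \<delta>" for j
    using rel w is_cong_refl[OF \<delta>] A by (auto simp: g_def)
  moreover have "(teval ops (case_sum y (g y)) ?H, teval ops (case_sum y (g z)) ?H) \<in> \<gamma>"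
    unfolding eval using A T w by (simp add: is_cong_refl[OF \<gamma>])
  moreover have "(y i, x i) \<in> \<delta>" for i using rel is_cong_sym[OF \<delta>] by blast
  ultimately have "(teval ops (case_sum x (g y)) ?H, teval ops (case_sum x (g z)) ?H) \<in> \<gamma>"
    using c H unfolding centralizes_def by blast
  then have "(w, m (?T (\<lambda>i. m (x i) (y i) (z i))) w w) \<in> \<gamma>"
    unfolding eval using A T w by (simp add: w_def)
  then show "(?T (\<lambda>i. m (x i) (y i) (z i)), m (?T x) (?T y) (?T z)) \<in> \<gamma>"
    using T w is_cong_sym[OF \<gamma>] by (simp add: w_def)
qed

lemma abelian_over_op:
  assumes ab: "abelian_over \<delta> \<gamma>" and \<delta>: "is_cong A ops \<delta>" and k: "k < length ops"
    and len: "length xs = fst (ops ! k)" "length ys = length xs" "length zs = length xs"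
    and rel: "\<And>i. i < length xs \<Longrightarrow> (xs ! i, ys ! i) \<in> \<delta>" "\<And>i. i < length xs \<Longrightarrow> (ys ! i, zs ! i) \<in> \<delta>"
  shows "(snd (ops ! k) (map (\<lambda>i. m (xs ! i) (ys ! i) (zs ! i)) [0..<length xs]),
          m (snd (ops ! k) xs) (snd (ops ! k) ys) (snd (ops ! k) zs)) \<in> \<gamma>"
proof -
  obtain a where a: "a \<in> A" using A_nonempty by blast
  \<comment> \<open>Environments are total, so the variables beyond the arity receive a default
    \<open>a\<close>, which is \<delta>-related to itself.\<close>
  define env where "env us i = (if i < length xs then us ! i else a)" for us :: "'a list" and i
  let ?t = "TOp k (map TVar [0..<length xs]) :: nat trm"
  have "twf ops ?t" using k len by simp
  moreover have "(env xs i, env ys i) \<in> \<delta> \<and> (env ys i, env zs i) \<in> \<delta>" for i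
    using rel is_cong_refl[OF \<delta> a] by (simp add: env_def)
  ultimately have t: "(teval ops (\<lambda>i. m (env xs i) (env ys i) (env zs i)) ?t,
      m (teval ops (env xs) ?t) (teval ops (env ys) ?t) (teval ops (env zs) ?t)) \<in> \<gamma>"
    using ab unfolding abelian_over_def by blast
  have env: "teval ops (env us) ?t = snd (ops ! k) us" if "length us = length xs" for us
  proof -
    have "map (teval ops (env us) \<circ> TVar) [0..<length xs] = us"
      using that by (intro nth_equalityI) (auto simp: env_def)
    then show ?thesis by simp
  qed
  have "map (teval ops (\<lambda>i. m (env xs i) (env ys i) (env zs i)) \<circ> TVar) [0..<length xs] =
      map (\<lambda>i. m (xs ! i) (ys ! i) (zs ! i)) [0..<length xs]"
    by (auto simp: env_def)
  then have "teval ops (\<lambda>i. m (env xs i) (env ys i) (env zs i)) ?t =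
      snd (ops ! k) (map (\<lambda>i. m (xs ! i) (ys ! i) (zs ! i)) [0..<length xs])"
    by (simp only: teval.simps map_map)
  with t show ?thesis by (simp only: env[OF refl] env[OF len(2)] env[OF len(3)])
qed

text \<open>The case of the term \<open>d\<close>: applying \<open>m\<close> to the rows and then to
  the results agrees modulo \<gamma> with doing so for the columns of a 3-by-3 array. Arrays with
  repeated entries, whose rows and columns the Malcev identities collapse, yield the group laws of
  the blocks.\<close>

lemma abelian_over_m:
  assumes ab: "abelian_over \<delta> \<gamma>"
    and "(x1, y1) \<in> \<delta>" "(y1, z1) \<in> \<delta>" "(x2, y2) \<in> \<delta>" "(y2, z2) \<in> \<delta>" "(x3, y3) \<in> \<delta>" "(y3, z3) \<in> \<delta>"
  shows "(m (m x1 y1 z1) (m x2 y2 z2) (m x3 y3 z3), m (m x1 x2 x3) (m y1 y2 y3) (m z1 z2 z3)) \<in> \<gamma>"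
proof -
  define e where "e u v w i = (if i = 0 then u else if i = 2 then w else v)" for u v w :: 'a and i :: nat
  have "(e x1 x2 x3 i, e y1 y2 y3 i) \<in> \<delta> \<and> (e y1 y2 y3 i, e z1 z2 z3 i) \<in> \<delta>" for i
    using assms by (simp add: e_def)
  then have "(teval ops (\<lambda>i. m (e x1 x2 x3 i) (e y1 y2 y3 i) (e z1 z2 z3 i)) d,
     m (teval ops (e x1 x2 x3) d) (teval ops (e y1 y2 y3) d) (teval ops (e z1 z2 z3) d)) \<in> \<gamma>"
    using ab wf_d unfolding abelian_over_def by blast
  moreover have "(\<lambda>i. m (e x1 x2 x3 i) (e y1 y2 y3 i) (e z1 z2 z3 i)) =
      e (m x1 y1 z1) (m x2 y2 z2) (m x3 y3 z3)" by (auto simp: e_def)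
  moreover have "teval ops (e u v w) d = m u v w" for u v w
    by (simp add: m_def e_def[abs_def])
  ultimately show ?thesis by simp
qed

end

section \<open>Abelian intervals: multiples and torsion\<close>

locale abelian_interval = malcev_algebra A ops d for A :: "'a set" and ops d +
  fixes \<delta> \<gamma> :: "'a rel"
  assumes \<delta>: "is_cong A ops \<delta>" and \<gamma>: "is_cong A ops \<gamma>" and le: "\<gamma> \<subseteq> \<delta>" and ab: "abelian_over \<delta> \<gamma>"
begin

lemmas \<delta>_rules = is_cong_refl[OF \<delta>] is_cong_sym[OF \<delta>] is_cong_trans[OF \<delta>] m_cong[OF \<delta>]

lemma \<delta>_carrier: "(x, y) \<in> \<delta> \<Longrightarrow> x \<in> A" "(x, y) \<in> \<delta> \<Longrightarrow> y \<in> A"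
  using is_cong_carrier[OF \<delta>] by auto

lemma \<gamma>_carrier: "(x, y) \<in> \<gamma> \<Longrightarrow> x \<in> A" "(x, y) \<in> \<gamma> \<Longrightarrow> y \<in> A"
  using is_cong_carrier[OF \<gamma>] by auto

lemma m_block: "\<lbrakk>(x, a) \<in> \<delta>; (y, a) \<in> \<delta>; (z, a) \<in> \<delta>\<rbrakk> \<Longrightarrow> (m x y z, a) \<in> \<delta>"
  using m_cong[OF \<delta>, of x a y a z a] \<delta>_carrier by simp

text \<open>The \<open>k\<close>-fold multiple of \<open>x\<close> when the block is read as a group
  with zero \<open>a\<close>, where the sum of \<open>u\<close> and \<open>x\<close> is
  \<open>u - a + x\<close>.\<close>

primrec mul :: "nat \<Rightarrow> 'a \<Rightarrow> 'a \<Rightarrow> 'a" where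
  "mul 0 x a = a"
| "mul (Suc k) x a = m (mul k x a) a x"

lemma mul_block: "(x, a) \<in> \<delta> \<Longrightarrow> (mul k x a, a) \<in> \<delta>"
proof (induction k)
  case 0
  then show ?case using \<delta>_carrier \<delta>_rules(1) by simp
next
  case (Suc k)
  then show ?case using \<delta>_carrier \<delta>_rules(1) by (auto intro: m_block)
qed

lemma mul_cong: "\<lbrakk>(x, x') \<in> \<gamma>; (a, a') \<in> \<gamma>\<rbrakk> \<Longrightarrow> (mul k x a, mul k x' a') \<in> \<gamma>"
  by (induction k) (auto intro: m_cong[OF \<gamma>])

lemma mul_idem: "a \<in> A \<Longrightarrow> mul k a a = a"
  by (induction k) auto

text \<open>Induction on \<open>n\<close>, as \<open>m\<close> passes through the operation by
  \<open>abelian_over_op\<close>. In group terms, an operation induces a homomorphism from the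
  product of the block groups with zeros \<open>ys ! i\<close> to the block group with zero
  \<open>snd (ops ! k) ys\<close>.\<close>

lemma mul_op:
  assumes k: "k < length ops" and len: "length xs = fst (ops ! k)" "length ys = length xs"
    and rel: "\<And>i. i < length xs \<Longrightarrow> (xs ! i, ys ! i) \<in> \<delta>"
  shows "(mul n (snd (ops ! k) xs) (snd (ops ! k) ys),
          snd (ops ! k) (map (\<lambda>i. mul n (xs ! i) (ys ! i)) [0..<length xs])) \<in> \<gamma>"
proof (induction n)
  case 0
  have "map (\<lambda>i. ys ! i) [0..<length xs] = ys" using len(2) map_nth[of ys] by simp
  moreover have "set ys \<subseteq> A" using rel \<delta>_carrier len by (metis in_set_conv_nth subsetI)
  ultimately show ?case using op_closed[OF k] len is_cong_refl[OF \<gamma>] by simp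
next
  case (Suc n)
  let ?f = "snd (ops ! k)"
  let ?zs = "map (\<lambda>i. mul n (xs ! i) (ys ! i)) [0..<length xs]"
  have sub: "set xs \<subseteq> A" "set ys \<subseteq> A" using rel \<delta>_carrier len by (metis in_set_conv_nth subsetI)+
  have f: "?f xs \<in> A" "?f ys \<in> A" using op_closed[OF k] len sub by simp_all
  have "(?zs ! i, ys ! i) \<in> \<delta>" "(ys ! i, xs ! i) \<in> \<delta>" if "i < length ?zs" for i
    using that rel mul_block \<delta>_rules(2) by auto
  then have "(?f (map (\<lambda>i. m (?zs ! i) (ys ! i) (xs ! i)) [0..<length ?zs]), m (?f ?zs) (?f ys) (?f xs)) \<in> \<gamma>"
    by (intro abelian_over_op[OF ab \<delta> k]) (use len in auto)
  moreover have "(m (mul n (?f xs) (?f ys)) (?f ys) (?f xs), m (?f ?zs) (?f ys) (?f xs)) \<in> \<gamma>"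
    by (rule m_cong[OF \<gamma> Suc.IH]) (use f is_cong_refl[OF \<gamma>] in auto)
  ultimately have "(m (mul n (?f xs) (?f ys)) (?f ys) (?f xs),
      ?f (map (\<lambda>i. m (?zs ! i) (ys ! i) (xs ! i)) [0..<length ?zs])) \<in> \<gamma>"
    using is_cong_sym[OF \<gamma>] is_cong_trans[OF \<gamma>] by blast
  moreover have "map (\<lambda>i. m (?zs ! i) (ys ! i) (xs ! i)) [0..<length ?zs] =
      map (\<lambda>i. mul (Suc n) (xs ! i) (ys ! i)) [0..<length xs]" by auto
  ultimately show ?case by (simp only: mul.simps)
qed

definition torsion :: "nat \<Rightarrow> 'a rel" where
  "torsion n = {(x, a) \<in> \<delta>. (mul n x a, a) \<in> \<gamma>}"

lemma torsion_le: "torsion n \<subseteq> \<delta>"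
  by (auto simp: torsion_def)

lemma torsion_ge: "\<gamma> \<subseteq> torsion n"
proof (clarsimp simp: torsion_def)
  fix x a assume "(x, a) \<in> \<gamma>"
  then have "(mul n x a, mul n a a) \<in> \<gamma>" "(x, a) \<in> \<delta>" "a \<in> A"
    using mul_cong is_cong_refl[OF \<gamma>] \<gamma>_carrier le by auto
  then show "(x, a) \<in> \<delta> \<and> (mul n x a, a) \<in> \<gamma>" by (simp add: mul_idem)
qed

text \<open>Multiples pass through operations by \<open>mul_op\<close>, so differences killed by
  \<open>n\<close> are mapped to differences killed by \<open>n\<close>. Symmetry and transitivity
  come from the Malcev term.\<close>

lemma torsion_is_cong: "is_cong A ops (torsion n)"
proof (rule reflexive_compatible_is_cong)
  show "torsion n \<subseteq> A \<times> A" using torsion_le \<delta>_carrier by fast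
  show "(a, a) \<in> torsion n" if "a \<in> A" for a
    using torsion_ge is_cong_refl[OF \<gamma> that] by blast
  show "compatible ops (torsion n)"
    unfolding compatible_def
  proof (intro allI impI, elim conjE)
    fix k xs ys assume k: "k < length ops" and len: "length xs = fst (ops ! k)" "length ys = length xs"
      and rel: "\<forall>i<length xs. (xs ! i, ys ! i) \<in> torsion n"
    let ?f = "snd (ops ! k)" and ?zs = "map (\<lambda>i. mul n (xs ! i) (ys ! i)) [0..<length xs]"
    have rel\<delta>: "(xs ! i, ys ! i) \<in> \<delta>" if "i < length xs" for i using that rel by (auto simp: torsion_def)
    have "(?f xs, ?f ys) \<in> \<delta>" using \<delta> k len rel\<delta> by (auto simp: is_cong_def)
    moreover have "(mul n (?f xs) (?f ys), ?f ?zs) \<in> \<gamma>" by (rule mul_op[OF k len rel\<delta>])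
    moreover have "(?f ?zs, ?f ys) \<in> \<gamma>"
      using \<gamma> k len rel unfolding is_cong_def by (auto simp: torsion_def)
    ultimately show "(?f xs, ?f ys) \<in> torsion n"
      using is_cong_trans[OF \<gamma>] by (auto simp: torsion_def)
  qed
qed

section \<open>Blocks modulo \<gamma> as finite abelian groups\<close>

definition rep :: "'a \<Rightarrow> 'a" where
  "rep x = (SOME y. (x, y) \<in> \<gamma>)"

lemma rep_rel: "x \<in> A \<Longrightarrow> (x, rep x) \<in> \<gamma>"
  unfolding rep_def by (rule someI_ex) (use is_cong_refl[OF \<gamma>] in blast)

lemma rep_eq_iff: "\<lbrakk>x \<in> A; y \<in> A\<rbrakk> \<Longrightarrow> rep x = rep y \<longleftrightarrow> (x, y) \<in> \<gamma>"
proof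
  assume A: "x \<in> A" "y \<in> A"
  show "(x, y) \<in> \<gamma>" if "rep x = rep y"
    using rep_rel[OF A(1)] rep_rel[OF A(2)] that is_cong_sym[OF \<gamma>] is_cong_trans[OF \<gamma>] by metis
  assume "(x, y) \<in> \<gamma>"
  then have "(x, z) \<in> \<gamma> \<longleftrightarrow> (y, z) \<in> \<gamma>" for z
    using is_cong_sym[OF \<gamma>] is_cong_trans[OF \<gamma>] by blast
  then show "rep x = rep y" by (simp add: rep_def)
qed

text \<open>The \<delta>-block of \<open>a\<close> modulo \<gamma> with zero \<open>a\<close> and
  sum \<open>x - a + y\<close>. Its elements are chosen representatives instead of \<gamma>-classes,
  so the carrier consists of elements of the algebra.\<close>

definition block_group :: "'a \<Rightarrow> 'a monoid" where
  "block_group a = \<lparr>carrier = rep ` {x. (x, a) \<in> \<delta>}, mult = (\<lambda>u v. rep (m u a v)), one = rep a\<rparr>"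

lemma block_group_mult:
  assumes "(x, a) \<in> \<delta>" "(y, a) \<in> \<delta>"
  shows "rep x \<otimes>\<^bsub>block_group a\<^esub> rep y = rep (m x a y)"
proof -
  have A: "x \<in> A" "y \<in> A" "a \<in> A" using assms \<delta>_carrier by auto
  have "(m x a y, m (rep x) a (rep y)) \<in> \<gamma>"
    by (intro m_cong[OF \<gamma>] rep_rel A is_cong_refl[OF \<gamma>])
  then show ?thesis using \<gamma>_carrier by (auto simp: block_group_def rep_eq_iff intro: is_cong_sym[OF \<gamma>])
qed

text \<open>Commutativity, associativity and inverses each come from one array in
  \<open>abelian_over_m\<close>: for commutativity the rows are \<open>(a, a, x)\<close>,
  \<open>(a, a, a)\<close>, \<open>(y, a, a)\<close>. The inverse of \<open>x\<close> is
  \<open>m a x a\<close>, that is \<open>a - x + a\<close>.\<close>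

lemma block_group_comm_group:
  assumes a: "a \<in> A"
  shows "comm_group (block_group a)"
proof -
  let ?G = "block_group a"
  have aa: "(a, a) \<in> \<delta>" using \<delta>_rules(1) a by simp
  have car: "u \<in> carrier ?G \<Longrightarrow> \<exists>x. (x, a) \<in> \<delta> \<and> u = rep x" for u
    by (auto simp: block_group_def)
  have inc: "(x, a) \<in> \<delta> \<Longrightarrow> rep x \<in> carrier ?G" for x by (auto simp: block_group_def)
  have one: "\<one>\<^bsub>?G\<^esub> = rep a" by (simp add: block_group_def)
  have bl: "\<And>x y. \<lbrakk>(x, a) \<in> \<delta>; (y, a) \<in> \<delta>\<rbrakk> \<Longrightarrow> (x, y) \<in> \<delta>" using \<delta>_rules(2,3) by blast
  have mb: "(m x y z, a) \<in> \<delta>" if "(x, a) \<in> \<delta>" "(y, a) \<in> \<delta>" "(z, a) \<in> \<delta>" for x y z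
    using that by (rule m_block)
  show ?thesis
  proof (rule comm_groupI)
    fix u v assume "u \<in> carrier ?G" "v \<in> carrier ?G"
    then obtain x y where xy: "(x, a) \<in> \<delta>" "u = rep x" "(y, a) \<in> \<delta>" "v = rep y" using car by metis
    then show "u \<otimes>\<^bsub>?G\<^esub> v \<in> carrier ?G" by (simp add: block_group_mult inc mb aa)
    have "(m (m a a x) (m a a a) (m y a a), m (m a a y) (m a a a) (m x a a)) \<in> \<gamma>"
      by (rule abelian_over_m[OF ab]) (use bl xy aa in auto)
    then have "(m x a y, m y a x) \<in> \<gamma>" using xy \<delta>_carrier a by auto
    then show "u \<otimes>\<^bsub>?G\<^esub> v = v \<otimes>\<^bsub>?G\<^esub> u" using xy \<gamma>_carrier by (simp add: block_group_mult rep_eq_iff)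
  next
    show "\<one>\<^bsub>?G\<^esub> \<in> carrier ?G" using inc aa one by simp
  next
    fix u v w assume "u \<in> carrier ?G" "v \<in> carrier ?G" "w \<in> carrier ?G"
    then obtain x y z where xyz: "(x, a) \<in> \<delta>" "u = rep x" "(y, a) \<in> \<delta>" "v = rep y" "(z, a) \<in> \<delta>" "w = rep z"
      using car by metis
    have "(m (m x a y) (m a a a) (m a a z), m (m x a a) (m a a a) (m y a z)) \<in> \<gamma>"
      by (rule abelian_over_m[OF ab]) (use bl xyz aa in auto)
    then have "(m (m x a y) a z, m x a (m y a z)) \<in> \<gamma>" using xyz \<delta>_carrier a by auto
    then show "u \<otimes>\<^bsub>?G\<^esub> v \<otimes>\<^bsub>?G\<^esub> w = u \<otimes>\<^bsub>?G\<^esub> (v \<otimes>\<^bsub>?G\<^esub> w)"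
      using xyz \<gamma>_carrier by (simp add: block_group_mult rep_eq_iff mb aa)
  next
    fix u assume "u \<in> carrier ?G"
    then obtain x where x: "(x, a) \<in> \<delta>" "u = rep x" using car by metis
    then have xA: "x \<in> A" using \<delta>_carrier by blast
    show "\<one>\<^bsub>?G\<^esub> \<otimes>\<^bsub>?G\<^esub> u = u" using x xA a by (simp add: one block_group_mult aa)
    have "(m (m a u' a) (m u' u' a) (m u' u' u'), m (m a u' u') (m u' u' u') (m a a u')) \<in> \<gamma>"
      if "(u', a) \<in> \<delta>" for u'
      by (rule abelian_over_m[OF ab]) (use bl that aa in auto)
    from this[OF x(1)] have "(m (m a x a) a x, a) \<in> \<gamma>" using xA a by simp
    then have "rep (m a x a) \<otimes>\<^bsub>?G\<^esub> u = \<one>\<^bsub>?G\<^esub>"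
      using x \<gamma>_carrier by (simp add: block_group_mult one rep_eq_iff mb aa)
    then show "\<exists>v\<in>carrier ?G. v \<otimes>\<^bsub>?G\<^esub> u = \<one>\<^bsub>?G\<^esub>" using inc mb x aa by blast
  qed
qed

lemma finite_block_group: "finite (carrier (block_group a))"
proof -
  have "{x. (x, a) \<in> \<delta>} \<subseteq> A" using \<delta>_carrier by blast
  then show ?thesis using finite_A by (simp add: block_group_def finite_subset)
qed

lemma block_group_pow:
  assumes x: "(x, a) \<in> \<delta>"
  shows "rep x [^]\<^bsub>block_group a\<^esub> n = rep (mul n x a)"
proof (induction n)
  case 0
  then show ?case by (simp add: block_group_def)
next
  case (Suc n)
  interpret comm_group "block_group a" by (rule block_group_comm_group[OF \<delta>_carrier(2)[OF x]])
  show ?case using Suc x by (simp add: block_group_mult mul_block)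
qed

text \<open>A pair outside \<gamma> gives a nonzero element \<open>x\<close> of the finite block
  group of \<open>a\<close>. If \<open>N\<close> is its order and \<open>p\<close> a prime divisor
  of \<open>N\<close>, the multiple of \<open>x\<close> by \<open>N / p\<close> is still nonzero but
  is killed by \<open>p\<close>.\<close>

lemma exists_torsion:
  assumes "\<gamma> \<noteq> \<delta>"
  obtains p where "prime p" and "\<gamma> \<subset> torsion p"
proof -
  obtain x a where xa: "(x, a) \<in> \<delta>" "(x, a) \<notin> \<gamma>" using assms le by auto
  then have A: "x \<in> A" "a \<in> A" using \<delta>_carrier by auto
  let ?G = "block_group a"
  interpret G: comm_group ?G by (rule block_group_comm_group[OF A(2)])
  have one: "\<one>\<^bsub>?G\<^esub> = rep a" by (simp add: block_group_def)
  have inc: "rep x \<in> carrier ?G" using xa by (auto simp: block_group_def)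
  have ne: "rep x \<noteq> \<one>\<^bsub>?G\<^esub>" using one rep_eq_iff xa A by simp
  let ?P = "\<lambda>n :: nat. 0 < n \<and> rep x [^]\<^bsub>?G\<^esub> n = \<one>\<^bsub>?G\<^esub>"
  define N where "N = Least ?P"
  have "\<exists>n. ?P n" using G.finite_imp_pow_eq_one[OF finite_block_group inc] by metis
  then have N: "?P N" unfolding N_def by (rule LeastI_ex)
  have least: "\<not> ?P n" if "n < N" for n using that not_less_Least unfolding N_def by blast
  have "N \<noteq> 1" using N ne inc by auto
  then obtain p where p: "prime p" "p dvd N" using prime_factor_nat by blast
  then obtain M where M: "N = M * p" by (metis dvd_div_mult_self)
  have M0: "M < N" "0 < M" using M N prime_gt_1_nat[OF p(1)] by auto
  let ?z = "mul M x a"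
  have z: "(?z, a) \<in> \<delta>" using mul_block xa by blast
  then have zA: "?z \<in> A" using \<delta>_carrier by blast
  have "(?z, a) \<notin> \<gamma>"
    using least[OF M0(1)] M0(2) xa one zA A by (simp add: block_group_pow rep_eq_iff)
  moreover have "(?z, a) \<in> torsion p"
  proof -
    have "rep (mul p ?z a) = (rep x [^]\<^bsub>?G\<^esub> M) [^]\<^bsub>?G\<^esub> p"
      using xa z by (simp add: block_group_pow)
    also have "\<dots> = rep a" using N inc one by (simp add: G.nat_pow_pow M)
    finally have "(mul p ?z a, a) \<in> \<gamma>"
      using rep_eq_iff \<delta>_carrier mul_block[OF z] A by blast
    then show ?thesis using z by (simp add: torsion_def)
  qed
  ultimately show thesis using that[OF p(1)] torsion_ge by blast
qed

section \<open>Affine maps from blocks to GF(p)\<close>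

text \<open>Such a map is defined on all of \<open>A\<close>, yet nothing relates its values on
  different \<delta>-blocks. The value 0 outside \<open>A\<close> makes the set finite, and moving
  \<open>\<chi> y\<close> to the left avoids subtraction of naturals.\<close>

definition affine_maps :: "nat \<Rightarrow> ('a \<Rightarrow> nat) set" where
  "affine_maps p = {\<chi>. (\<forall>x. (x \<in> A \<longrightarrow> \<chi> x \<in> {..<p}) \<and> (x \<notin> A \<longrightarrow> \<chi> x = 0)) \<and>
     (\<forall>(x, y)\<in>\<gamma>. \<chi> x = \<chi> y) \<and>
     (\<forall>x y z. (x, y) \<in> \<delta> \<longrightarrow> (y, z) \<in> \<delta> \<longrightarrow> [\<chi> (m x y z) + \<chi> y = \<chi> x + \<chi> z] (mod p))}"

lemma finite_affine_maps: "finite (affine_maps p)"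
proof (rule finite_subset)
  show "affine_maps p \<subseteq> {\<chi>. \<forall>x. (x \<in> A \<longrightarrow> \<chi> x \<in> {..<p}) \<and> (x \<notin> A \<longrightarrow> \<chi> x = 0)}"
    by (auto simp: affine_maps_def)
  show "finite \<dots>" using finite_set_of_finite_funs[OF finite_A, of "{..<p}" 0] by simp
qed

text \<open>A character of the block group of \<open>a\<close> that does not vanish at
  \<open>x\<close>, extended by 0 to the other blocks. The extension is affine on every block since
  a triple chained by \<delta> lies in one block together with \<open>m x y z\<close>. It vanishes
  at the zero \<open>a\<close>.\<close>

lemma affine_maps_separate:
  assumes p: "prime p" and tors: "\<delta> \<subseteq> torsion p" and xa: "(x, a) \<in> \<delta>" "(x, a) \<notin> \<gamma>"
  obtains \<chi> where "\<chi> \<in> affine_maps p" and "\<chi> x \<noteq> \<chi> a"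
proof -
  have A: "x \<in> A" "a \<in> A" using xa \<delta>_carrier by auto
  let ?G = "block_group a"
  interpret G: comm_group ?G by (rule block_group_comm_group[OF A(2)])
  have one: "\<one>\<^bsub>?G\<^esub> = rep a" by (simp add: block_group_def)
  have inc: "rep z \<in> carrier ?G" if "(z, a) \<in> \<delta>" for z using that by (auto simp: block_group_def)
  have aa: "(a, a) \<in> \<delta>" using \<delta>_rules(1) A by simp
  have ne: "rep x \<noteq> \<one>\<^bsub>?G\<^esub>" using one rep_eq_iff xa A by simp
  have "g [^]\<^bsub>?G\<^esub> p = \<one>\<^bsub>?G\<^esub>" if g: "g \<in> carrier ?G" for g
  proof -
    obtain z where z: "(z, a) \<in> \<delta>" "g = rep z" using g by (auto simp: block_group_def)
    then have "(mul p z a, a) \<in> \<gamma>" using tors by (auto simp: torsion_def)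
    then show ?thesis using z one by (simp add: block_group_pow rep_eq_iff \<gamma>_carrier A)
  qed
  then obtain c :: "'a \<Rightarrow> nat" where
    c: "\<And>g h. \<lbrakk>g \<in> carrier ?G; h \<in> carrier ?G\<rbrakk> \<Longrightarrow> [c (g \<otimes>\<^bsub>?G\<^esub> h) = c g + c h] (mod p)"
    and cx: "\<not> [c (rep x) = 0] (mod p)"
    using G.exists_character[OF finite_block_group p _ inc[OF xa(1)] ne] by blast
  define \<chi> where "\<chi> z = (if (z, a) \<in> \<delta> then c (rep z) mod p else 0)" for z
  have "\<chi> \<in> affine_maps p"
    unfolding affine_maps_def
  proof (intro CollectI conjI allI impI ballI)
    fix z show "\<chi> z \<in> {..<p}" using prime_gt_0_nat[OF p] by (simp add: \<chi>_def)
    show "\<chi> z = 0" if "z \<notin> A" using that \<delta>_carrier by (auto simp: \<chi>_def)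
  next
    fix e assume "e \<in> \<gamma>"
    then obtain y z where e: "e = (y, z)" "(y, z) \<in> \<gamma>" by (cases e) auto
    then have "rep y = rep z" using rep_eq_iff \<gamma>_carrier by blast
    moreover have "(y, a) \<in> \<delta> \<longleftrightarrow> (z, a) \<in> \<delta>" using e le \<delta>_rules(2,3) by blast
    ultimately show "case e of (x, y) \<Rightarrow> \<chi> x = \<chi> y" using e by (simp add: \<chi>_def)
  next
    fix x y z assume xyz: "(x, y) \<in> \<delta>" "(y, z) \<in> \<delta>"
    show "[\<chi> (m x y z) + \<chi> y = \<chi> x + \<chi> z] (mod p)"
    proof (cases "(y, a) \<in> \<delta>")
      case True
      then have bl: "(x, a) \<in> \<delta>" "(z, a) \<in> \<delta>" "(m x y z, a) \<in> \<delta>"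
        using \<delta>_rules(3)[OF xyz(1) True] \<delta>_rules(3)[OF \<delta>_rules(2)[OF xyz(2)] True]
        by (auto intro: m_block)
      then have rels: "(x, y) \<in> \<delta>" "(y, z) \<in> \<delta>" "(a, y) \<in> \<delta>" "(y, y) \<in> \<delta>"
        using xyz \<delta>_rules(2)[OF True] \<delta>_rules(1) \<delta>_carrier by auto
      \<comment> \<open>This array says that \<open>(x - y + z) + y = x + z\<close> in the group
        with zero \<open>a\<close>, whatever point \<open>y\<close> of the block is used.\<close>
      have "(m (m x y z) (m a y y) (m a a y), m (m x a a) (m y y a) (m z y y)) \<in> \<gamma>"
        by (rule abelian_over_m[OF ab]) (use rels aa in auto)
      then have "(m (m x y z) a y, m x a z) \<in> \<gamma>" using xyz True \<delta>_carrier A by simp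
      then have eq: "rep (m x y z) \<otimes>\<^bsub>?G\<^esub> rep y = rep x \<otimes>\<^bsub>?G\<^esub> rep z"
        using bl True \<gamma>_carrier by (simp add: block_group_mult rep_eq_iff)
      have "[c (rep (m x y z)) + c (rep y) = c (rep (m x y z) \<otimes>\<^bsub>?G\<^esub> rep y)] (mod p)"
        using c inc bl True cong_sym by blast
      moreover have "[c (rep (m x y z) \<otimes>\<^bsub>?G\<^esub> rep y) = c (rep x) + c (rep z)] (mod p)"
        unfolding eq using c inc bl by blast
      ultimately have "[c (rep (m x y z)) + c (rep y) = c (rep x) + c (rep z)] (mod p)"
        using cong_trans by blast
      then show ?thesis using bl True by (simp add: \<chi>_def cong_def mod_simps)
    next
      case False
      then have "(x, a) \<notin> \<delta>" "(z, a) \<notin> \<delta>"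
        using \<delta>_rules(3)[OF \<delta>_rules(2)[OF xyz(1)]] \<delta>_rules(3)[OF xyz(2)] by auto
      moreover have "(m x y z, a) \<notin> \<delta>"
      proof
        assume "(m x y z, a) \<in> \<delta>"
        moreover have "(m x y z, y) \<in> \<delta>"
          by (rule m_block) (use xyz \<delta>_rules(1,2) \<delta>_carrier in auto)
        ultimately show False using False \<delta>_rules(3)[OF \<delta>_rules(2)] by blast
      qed
      ultimately show ?thesis using False by (simp add: \<chi>_def)
    qed
  qed
  moreover have "\<chi> x \<noteq> \<chi> a"
  proof -
    have "[c (rep a) = c (rep a) + c (rep a)] (mod p)"
      using c[OF inc[OF aa] inc[OF aa]] one by (metis G.l_one inc aa)
    then have "[c (rep a) = 0] (mod p)" by (metis cong_add_lcancel_0_nat cong_sym)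
    then show ?thesis using cx xa aa by (simp add: \<chi>_def cong_def)
  qed
  ultimately show thesis using that by blast
qed

end

context abelian_interval
begin

lemma affine_mapsD:
  assumes "\<chi> \<in> affine_maps p"
  shows "x \<in> A \<Longrightarrow> \<chi> x < p" and "(x, y) \<in> \<gamma> \<Longrightarrow> \<chi> x = \<chi> y"
    and "\<lbrakk>(x, y) \<in> \<delta>; (y, z) \<in> \<delta>\<rbrakk> \<Longrightarrow> [\<chi> (m x y z) + \<chi> y = \<chi> x + \<chi> z] (mod p)"
  using assms unfolding affine_maps_def by fast+

lemma affine_op:
  assumes \<chi>: "\<chi> \<in> affine_maps p" and k: "k < length ops"
    and len: "length xs = fst (ops ! k)" "length ys = length xs" "length zs = length xs" "length us = length xs"
    and rel: "\<And>i. i < length xs \<Longrightarrow> (xs ! i, ys ! i) \<in> \<delta>" "\<And>i. i < length xs \<Longrightarrow> (ys ! i, zs ! i) \<in> \<delta>"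
    and us: "\<And>i. i < length xs \<Longrightarrow> us ! i = m (xs ! i) (ys ! i) (zs ! i)"
  shows "[\<chi> (snd (ops ! k) us) + \<chi> (snd (ops ! k) ys) = \<chi> (snd (ops ! k) xs) + \<chi> (snd (ops ! k) zs)] (mod p)"
proof -
  let ?f = "snd (ops ! k)"
  have "us = map (\<lambda>i. m (xs ! i) (ys ! i) (zs ! i)) [0..<length xs]"
    using len us by (intro nth_equalityI) auto
  then have "(?f us, m (?f xs) (?f ys) (?f zs)) \<in> \<gamma>"
    using abelian_over_op[OF ab \<delta> k len(1-3) rel] by simp
  then have "\<chi> (?f us) = \<chi> (m (?f xs) (?f ys) (?f zs))" by (rule affine_mapsD(2)[OF \<chi>])
  moreover have "(?f xs, ?f ys) \<in> \<delta>" "(?f ys, ?f zs) \<in> \<delta>"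
    using \<delta> k len rel by (auto simp: is_cong_def)
  ultimately show ?thesis using affine_mapsD(3)[OF \<chi>] by metis
qed

text \<open>The map \<open>\<chi>\<close> composed with the unary polynomial that leaves only
  argument \<open>s\<close> free, restricted to the block of \<open>es ! s\<close>. Off that block
  it is set to 0, since the expansion evaluates it only there.\<close>

definition shift :: "('a \<Rightarrow> nat) \<Rightarrow> nat \<Rightarrow> 'a list \<Rightarrow> nat \<Rightarrow> 'a \<Rightarrow> nat" where
  "shift \<chi> k es s y = (if (y, es ! s) \<in> \<delta> then \<chi> (snd (ops ! k) (es[s := y])) else 0)"

lemma shift_affine:
  assumes \<chi>: "\<chi> \<in> affine_maps p" and "p > 0" and k: "k < length ops"
    and es: "length es = fst (ops ! k)" "set es \<subseteq> A" and s: "s < length es"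
  shows "shift \<chi> k es s \<in> affine_maps p"
  unfolding affine_maps_def
proof (intro CollectI conjI allI impI ballI)
  let ?f = "snd (ops ! k)"
  fix z
  show "shift \<chi> k es s z \<in> {..<p}" if z: "z \<in> A"
  proof -
    have "?f (es[s := z]) \<in> A"
      using op_closed[OF k, of "es[s := z]"] es set_update_subsetI[OF es(2) z] by simp
    then show ?thesis using affine_mapsD(1)[OF \<chi>] \<open>p > 0\<close> by (simp add: shift_def)
  qed
  show "shift \<chi> k es s z = 0" if "z \<notin> A" using that \<delta>_carrier by (auto simp: shift_def)
next
  let ?f = "snd (ops ! k)"
  fix e assume "e \<in> \<gamma>"
  then obtain y z where e: "e = (y, z)" "(y, z) \<in> \<gamma>" by (cases e) auto
  have "(es[s := y] ! i, es[s := z] ! i) \<in> \<gamma>" if "i < length es" for i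
    using that e(2) is_cong_refl[OF \<gamma> subsetD[OF es(2) nth_mem[OF that]]] by (cases "i = s") auto
  then have "(?f (es[s := y]), ?f (es[s := z])) \<in> \<gamma>" using \<gamma> k es by (simp add: is_cong_def)
  then have "\<chi> (?f (es[s := y])) = \<chi> (?f (es[s := z]))" by (rule affine_mapsD(2)[OF \<chi>])
  moreover have "(y, es ! s) \<in> \<delta> \<longleftrightarrow> (z, es ! s) \<in> \<delta>"
    using e(2) le \<delta>_rules(3)[of y z] \<delta>_rules(3)[of z y] \<delta>_rules(2)[of y z] by blast
  ultimately show "case e of (x, y) \<Rightarrow> shift \<chi> k es s x = shift \<chi> k es s y"
    using e(1) by (simp add: shift_def)
next
  let ?f = "snd (ops ! k)"
  fix x y z assume xyz: "(x, y) \<in> \<delta>" "(y, z) \<in> \<delta>"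
  have xyzA: "x \<in> A" "y \<in> A" "z \<in> A" using xyz \<delta>_carrier by auto
  have my: "(m x y z, y) \<in> \<delta>" by (rule m_block) (use xyz \<delta>_rules(1,2) xyzA in auto)
  have same: "(u, es ! s) \<in> \<delta> \<longleftrightarrow> (y, es ! s) \<in> \<delta>" if "(u, y) \<in> \<delta>" for u
    using \<delta>_rules(3)[of u y] \<delta>_rules(3)[of y u] \<delta>_rules(2)[of u y] that by blast
  note same = same[OF my] same[OF xyz(1)] same[OF \<delta>_rules(2)[OF xyz(2)]]
  have "[\<chi> (?f (es[s := m x y z])) + \<chi> (?f (es[s := y])) =
      \<chi> (?f (es[s := x])) + \<chi> (?f (es[s := z]))] (mod p)"
    by (rule affine_op[OF \<chi> k])
      (use s es xyz xyzA \<delta>_rules(1) subsetD[OF es(2) nth_mem] in \<open>auto simp: nth_list_update\<close>)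
  then show "[shift \<chi> k es s (m x y z) + shift \<chi> k es s y = shift \<chi> k es s x + shift \<chi> k es s z] (mod p)"
    unfolding shift_def same by simp
qed

text \<open>Changing the arguments from \<open>es\<close> to \<open>vs\<close> one coordinate at a time adds up the increments of \<open>\<chi>\<close>.\<close>

lemma affine_expansion:
  assumes \<chi>: "\<chi> \<in> affine_maps p" and "p > 0" and k: "k < length ops"
    and es: "length es = fst (ops ! k)" and vs: "length vs = length es"
    and rel: "\<And>i. i < length es \<Longrightarrow> (vs ! i, es ! i) \<in> \<delta>"
  shows "[\<chi> (snd (ops ! k) vs) = (1 + (p - 1) * length es) * \<chi> (snd (ops ! k) es)
    + (\<Sum>s<length es. shift \<chi> k es s (vs ! s))] (mod p)"
proof -
  let ?f = "snd (ops ! k)" and ?r = "length es"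
  define u where "u n = map (\<lambda>i. if i < n then vs ! i else es ! i) [0..<?r]" for n
  have carr: "vs ! i \<in> A" "es ! i \<in> A" if "i < ?r" for i using rel[OF that] \<delta>_carrier by auto
  have "[\<chi> (?f (u n)) + n * \<chi> (?f es) = \<chi> (?f es) + (\<Sum>s<n. shift \<chi> k es s (vs ! s))] (mod p)"
    if "n \<le> ?r" for n
    using that
  proof (induction n)
    case 0
    have "u 0 = es" by (simp add: u_def map_nth)
    then show ?case by simp
  next
    case (Suc n)
    then have n: "n < ?r" by simp
    \<comment> \<open>Coordinatewise, \<open>u (Suc n)\<close> is
      \<open>u n - es + es[n := vs ! n]\<close>: at position \<open>n\<close> the first two terms
      cancel, elsewhere the last two do.\<close>
    have "[\<chi> (?f (u (Suc n))) + \<chi> (?f es) = \<chi> (?f (u n)) + \<chi> (?f (es[n := vs ! n]))] (mod p)"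
      by (rule affine_op[OF \<chi> k])
        (use n es carr rel \<delta>_rules(1,2) in \<open>auto simp: u_def nth_list_update less_Suc_eq\<close>)
    then have "[\<chi> (?f (u (Suc n))) + \<chi> (?f es) = \<chi> (?f (u n)) + shift \<chi> k es n (vs ! n)] (mod p)"
      using rel[OF n] by (simp add: shift_def)
    then have "[(\<chi> (?f (u (Suc n))) + \<chi> (?f es)) + n * \<chi> (?f es) =
        (\<chi> (?f (u n)) + shift \<chi> k es n (vs ! n)) + n * \<chi> (?f es)] (mod p)"
      by (rule cong_add) simp
    moreover have "[(\<chi> (?f (u n)) + n * \<chi> (?f es)) + shift \<chi> k es n (vs ! n) =
        (\<chi> (?f es) + (\<Sum>s<n. shift \<chi> k es s (vs ! s))) + shift \<chi> k es n (vs ! n)] (mod p)"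
      by (rule cong_add) (use Suc in simp_all)
    ultimately show ?case by (simp add: algebra_simps cong_def)
  qed
  moreover have "u ?r = vs" unfolding u_def using vs by (intro nth_equalityI) auto
  ultimately have "[\<chi> (?f vs) + ?r * \<chi> (?f es) = \<chi> (?f es) + (\<Sum>s<?r. shift \<chi> k es s (vs ! s))] (mod p)"
    by (metis order_refl)
  \<comment> \<open>Adding \<open>p - 1\<close> further copies of the term on the left turns it into
    a multiple of \<open>p\<close>. This is where the coefficient
    \<open>1 + (p - 1) * length es\<close>, a natural number standing for one minus the arity, comes
    from.\<close>
  then have "[\<chi> (?f vs) + ?r * \<chi> (?f es) + (p - 1) * ?r * \<chi> (?f es) =
      \<chi> (?f es) + (\<Sum>s<?r. shift \<chi> k es s (vs ! s)) + (p - 1) * ?r * \<chi> (?f es)] (mod p)"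
    by (rule cong_add) simp
  moreover have "\<chi> (?f vs) + ?r * \<chi> (?f es) + (p - 1) * ?r * \<chi> (?f es) = \<chi> (?f vs) + p * (?r * \<chi> (?f es))"
    using \<open>p > 0\<close> by (cases p) (auto simp: algebra_simps)
  ultimately show ?thesis by (simp add: cong_def algebra_simps)
qed

end

subsection \<open>Circuits over the algebra\<close>

text \<open>The base \<open>Suc n\<close> is at least 1, so exponents may be raised freely and
  \<open>n = 0\<close> is no exception.\<close>

definition poly_bounded :: "(nat \<Rightarrow> nat) \<Rightarrow> bool" where
  "poly_bounded f \<longleftrightarrow> (\<exists>c e. \<forall>n. f n \<le> c * Suc n ^ e)"

lemma poly_bounded_const: "poly_bounded (\<lambda>n. c)"
  unfolding poly_bounded_def by (intro exI[of _ c] exI[of _ 0]) simp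

lemma poly_bounded_id: "poly_bounded (\<lambda>n. n)"
  unfolding poly_bounded_def by (intro exI[of _ 1]) simp

lemma poly_bounded_add:
  assumes "poly_bounded f" and "poly_bounded g"
  shows "poly_bounded (\<lambda>n. f n + g n)"
proof -
  obtain c e c' e' where b: "\<And>n. f n \<le> c * Suc n ^ e" "\<And>n. g n \<le> c' * Suc n ^ e'"
    using assms unfolding poly_bounded_def by blast
  have "f n + g n \<le> (c + c') * Suc n ^ (e + e')" for n
  proof -
    have "Suc n ^ e \<le> Suc n ^ (e + e')" "Suc n ^ e' \<le> Suc n ^ (e + e')"
      by (intro power_increasing; simp)+
    then have "c * Suc n ^ e + c' * Suc n ^ e' \<le> c * Suc n ^ (e + e') + c' * Suc n ^ (e + e')"
      by (intro add_mono mult_le_mono2)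
    then show ?thesis using b[of n] unfolding add_mult_distrib by linarith
  qed
  then show ?thesis unfolding poly_bounded_def by blast
qed

lemma poly_bounded_mult:
  assumes "poly_bounded f" and "poly_bounded g"
  shows "poly_bounded (\<lambda>n. f n * g n)"
proof -
  obtain c e c' e' where b: "\<And>n. f n \<le> c * Suc n ^ e" "\<And>n. g n \<le> c' * Suc n ^ e'"
    using assms unfolding poly_bounded_def by blast
  have "f n * g n \<le> (c * c') * Suc n ^ (e + e')" for n
    using mult_le_mono[OF b] by (simp add: power_add mult.assoc mult.left_commute)
  then show ?thesis unfolding poly_bounded_def by blast
qed

lemma poly_bounded_power: "poly_bounded f \<Longrightarrow> poly_bounded (\<lambda>n. f n ^ k)"
  by (induction k) (auto intro: poly_bounded_mult poly_bounded_const)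

lemma poly_bounded_mono: "\<lbrakk>poly_bounded g; \<And>n. f n \<le> g n\<rbrakk> \<Longrightarrow> poly_bounded f"
  unfolding poly_bounded_def by (meson le_trans)

lemma poly_bounded_compose:
  assumes "poly_bounded f" and "poly_bounded g"
  shows "poly_bounded (\<lambda>n. f (g n))"
proof -
  obtain c e where f: "\<And>n. f n \<le> c * Suc n ^ e" using assms unfolding poly_bounded_def by blast
  have "poly_bounded (\<lambda>n. c * (g n + 1) ^ e)"
    by (intro poly_bounded_mult poly_bounded_power poly_bounded_add poly_bounded_const assms)
  then show ?thesis by (rule poly_bounded_mono) (use f in simp)
qed

lemmas poly_bounded_intros =
  poly_bounded_const poly_bounded_id poly_bounded_add poly_bounded_mult poly_bounded_power

lemma computable_mono: "\<lbrakk>computable ps n Z F; Z \<le> Z'\<rbrakk> \<Longrightarrow> computable ps n Z' F"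
  unfolding computable_def using le_trans by blast

lemma computable_layer_le:
  assumes "prime p" and "computable ps n Z F" and "\<And>g. g \<in> set G \<Longrightarrow> linear_bit p n F N M g"
    and "length F \<le> a" and "length G \<le> b"
  shows "computable (p # ps) n (Z + b * (a + 2 * N + 1 + N * M)) G"
proof (rule computable_mono)
  show "computable (p # ps) n (Z + length G * (length F + 2 * N + 1 + N * M)) G"
    using assms(1-3) by (rule computable_layer)
  show "Z + length G * (length F + 2 * N + 1 + N * M) \<le> Z + b * (a + 2 * N + 1 + N * M)"
    using assms(4,5) by (intro add_left_mono mult_le_mono add_mono) auto
qed

lemma linear_bit_mem:
  assumes "p > 1" and "f \<in> set F" and "N \<ge> 1" and "M \<ge> 1"
  shows "linear_bit p n F N M f"
  by (rule linear_bit_conj[where fs = "[f]"]) (use assms in auto)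

lemma sum_list_single:
  fixes g :: "'b \<Rightarrow> 'c :: comm_monoid_add"
  assumes "distinct xs" and "e \<in> set xs" and "\<And>x. \<lbrakk>x \<in> set xs; x \<noteq> e\<rbrakk> \<Longrightarrow> g x = 0"
  shows "sum_list (map g xs) = g e"
proof -
  have "sum_list (map g xs) = sum g (set xs)" using assms(1) by (simp add: sum_list_distinct_conv_sum_set)
  also have "\<dots> = sum g {e}" by (rule sum.mono_neutral_right) (use assms in auto)
  finally show ?thesis by simp
qed

section \<open>Runs of a circuit and the bits that describe them\<close>

definition is_run :: "'a ops \<Rightarrow> nat \<Rightarrow> 'a cnode list \<Rightarrow> (bool \<Rightarrow> 'a) \<Rightarrow> (bool list \<Rightarrow> nat \<Rightarrow> 'a) \<Rightarrow> bool" where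
  "is_run ops n C \<iota> v \<longleftrightarrow> (\<forall>x j. length x = n \<longrightarrow> j < length C \<longrightarrow> v x j =
     (case C ! j of CIn q \<Rightarrow> \<iota> (x ! q) | CConst a \<Rightarrow> a | CGate k js \<Rightarrow> snd (ops ! k) (map (v x) js)))"

context malcev_algebra
begin

definition elems :: "'a list" where
  "elems = (SOME xs. set xs = A)"

lemma set_elems [simp]: "set elems = A"
  unfolding elems_def using finite_list[OF finite_A] by (rule someI_ex)

text \<open>What one level hands to the next. The constant and both literals of each input accompany
  the block bits because a gate reads only the layer directly below, while every later linear system
  needs them for its input and constant nodes.\<close>

definition state :: "nat \<Rightarrow> nat \<Rightarrow> (bool list \<Rightarrow> nat \<Rightarrow> 'a) \<Rightarrow> 'a rel \<Rightarrow> (bool list \<Rightarrow> bool) list" where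
  "state n l v \<theta> = (\<lambda>x. True) # map (\<lambda>q x. x ! q) [0..<n] @ map (\<lambda>q x. \<not> x ! q) [0..<n] @
     concat (map (\<lambda>j. map (\<lambda>a x. (v x j, a) \<in> \<theta>) elems) [0..<l])"

lemma set_state: "set (state n l v \<theta>) = {\<lambda>x. True} \<union> (\<lambda>q x. x ! q) ` {..<n} \<union> (\<lambda>q x. \<not> x ! q) ` {..<n} \<union>
    (\<Union>j<l. (\<lambda>a x. (v x j, a) \<in> \<theta>) ` A)"
  by (auto simp: state_def lessThan_atLeast0)

lemma stateE:
  assumes "g \<in> set (state n l v \<theta>)"
  obtains "g = (\<lambda>x. True)" | q where "q < n" "g = (\<lambda>x. x ! q)" | q where "q < n" "g = (\<lambda>x. \<not> x ! q)"
    | j a where "j < l" "a \<in> A" "g = (\<lambda>x. (v x j, a) \<in> \<theta>)"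
  using assms unfolding set_state by blast

lemma length_state: "length (state n l v \<theta>) = 1 + 2 * n + l * length elems"
  by (simp add: state_def length_concat comp_def sum_list_triv)

lemma length_state_le: "\<lbrakk>n \<le> K; l \<le> K\<rbrakk> \<Longrightarrow> length (state n l v \<theta>) \<le> 1 + 2 * K + K * length elems"
  unfolding length_state by (intro add_mono mult_le_mono) auto

text \<open>The primes and the bound are chosen before the circuit, so they depend only on the
  algebra and \<theta>. A single parameter \<open>K\<close> dominates both the number of inputs and
  the number of nodes, which makes bounds in one variable sufficient.\<close>

definition resolvable :: "'a rel \<Rightarrow> bool" where
  "resolvable \<theta> \<longleftrightarrow> (\<exists>ps f. (\<forall>p\<in>set ps. prime p) \<and> poly_bounded f \<and>
     (\<forall>n C \<iota> v K. circuit_wf A ops n C \<longrightarrow> range \<iota> \<subseteq> A \<longrightarrow> is_run ops n C \<iota> v \<longrightarrow> n \<le> K \<longrightarrow> length C \<le> K \<longrightarrow>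
        computable ps n (f K) (state n (length C) v \<theta>)))"

lemma run_closed:
  assumes C: "circuit_wf A ops n C" and \<iota>: "range \<iota> \<subseteq> A" and v: "is_run ops n C \<iota> v"
    and x: "length x = n" and "j < length C"
  shows "v x j \<in> A"
  using \<open>j < length C\<close>
proof (induction j rule: less_induct)
  case (less j)
  have vj: "v x j = (case C ! j of CIn q \<Rightarrow> \<iota> (x ! q) | CConst a \<Rightarrow> a | CGate k js \<Rightarrow> snd (ops ! k) (map (v x) js))"
    using v x less.prems by (simp add: is_run_def)
  have wf: "case C ! j of CIn q \<Rightarrow> q < n | CConst a \<Rightarrow> a \<in> A
      | CGate k js \<Rightarrow> k < length ops \<and> length js = fst (ops ! k) \<and> (\<forall>i\<in>set js. i < j)"
    using C less.prems by (auto simp: circuit_wf_def)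
  show ?case
  proof (cases "C ! j")
    case (CGate k js)
    then have "set (map (v x) js) \<subseteq> A" using less wf by auto
    then show ?thesis using vj wf CGate op_closed by simp
  qed (use vj wf \<iota> in auto)
qed

text \<open>All block bits of the full relation are constantly true, so one layer suffices: it
  copies the inputs and supplies the constant and the negated inputs. The prime 2 is an arbitrary
  choice.\<close>

lemma resolvable_full: "resolvable (A \<times> A)"
  unfolding resolvable_def
proof (intro exI conjI allI impI)
  let ?f = "\<lambda>K. 0 + (1 + 2 * K + K * length elems) * (K + 2 * 1 + 1 + 1 * 1)"
  show "\<forall>p\<in>set [2::nat]. prime p" by simp
  show "poly_bounded ?f" by (intro poly_bounded_intros)
  fix n C \<iota> v K
  assume wf: "circuit_wf A ops n C" "range \<iota> \<subseteq> A" "is_run ops n C \<iota> v" and K: "n \<le> K" "length C \<le> K"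
  show "computable [2] n (?f K) (state n (length C) v (A \<times> A))"
  proof (rule computable_layer_le[OF _ computable_inputs])
    let ?F = "map (\<lambda>q x. x ! q) [0..<n] :: (bool list \<Rightarrow> bool) list"
    fix g assume "g \<in> set (state n (length C) v (A \<times> A))"
    then show "linear_bit 2 n ?F 1 1 g"
    proof (cases rule: stateE)
      case 1
      then show ?thesis by (intro linear_bit_conj[where fs = "[]"]) auto
    next
      case (2 q)
      then show ?thesis by (intro linear_bit_mem) auto
    next
      case (3 q)
      then show ?thesis by (intro linear_bit_count[where fs = "[\<lambda>x. x ! q]" and T = "{0}"]) auto
    next
      case (4 j a)
      then show ?thesis using run_closed[OF wf] by (intro linear_bit_conj[where fs = "[]"]) auto
    qed
  qed (use K length_state_le in auto)
qed

end

lemma length_n_lists_le: "r \<le> r' \<Longrightarrow> length (List.n_lists r xs) \<le> Suc (length xs) ^ r'"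
proof -
  assume "r \<le> r'"
  have "length xs ^ r \<le> Suc (length xs) ^ r" by (rule power_mono) auto
  also have "\<dots> \<le> Suc (length xs) ^ r'" using \<open>r \<le> r'\<close> by (intro power_increasing) auto
  finally show ?thesis by (simp add: length_n_lists)
qed

lemma length_concat_map_le:
  assumes "\<And>x. x \<in> set xs \<Longrightarrow> length (h x) \<le> b"
  shows "length (concat (map h xs)) \<le> length xs * b"
proof -
  have "sum_list (map (\<lambda>x. length (h x)) xs) \<le> sum_list (map (\<lambda>x. b) xs)"
    by (rule sum_list_mono) (use assms in auto)
  then show ?thesis by (simp add: length_concat comp_def sum_list_triv)
qed

fun cargs :: "'a cnode \<Rightarrow> nat list" where
  "cargs (CGate k js) = js"
| "cargs _ = []"

subsection \<open>One step down an elementary abelian interval\<close>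

locale elementary_interval = abelian_interval A ops d \<delta> \<gamma> for A :: "'a set" and ops d \<delta> \<gamma> +
  fixes p :: nat
  assumes prime: "prime p" and elementary: "\<delta> \<subseteq> torsion p"
begin

definition block_rep :: "'a \<Rightarrow> 'a" where
  "block_rep x = (SOME y. (x, y) \<in> \<delta>)"

lemma block_rep_rel: "x \<in> A \<Longrightarrow> (x, block_rep x) \<in> \<delta>"
  unfolding block_rep_def by (rule someI_ex) (use \<delta>_rules(1) in blast)

lemma block_rep_eq: "(x, y) \<in> \<delta> \<Longrightarrow> block_rep x = block_rep y"
proof -
  assume "(x, y) \<in> \<delta>"
  then have "(x, z) \<in> \<delta> \<longleftrightarrow> (y, z) \<in> \<delta>" for z
    using \<delta>_rules(3)[of x y] \<delta>_rules(3)[of y x] \<delta>_rules(2)[of x y] by blast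
  then show ?thesis by (simp add: block_rep_def)
qed

text \<open>Duplicates are removed because a block listed twice would be counted twice in the sums
  over tuples of blocks.\<close>

definition reps :: "'a list" where
  "reps = remdups (map block_rep elems)"

lemma reps_rel: "e \<in> set reps \<Longrightarrow> x \<in> A \<Longrightarrow> (x, e) \<in> \<delta> \<longleftrightarrow> e = block_rep x"
proof -
  assume "e \<in> set reps" and x: "x \<in> A"
  then obtain y where y: "y \<in> A" "e = block_rep y" by (auto simp: reps_def)
  show ?thesis
  proof
    assume "(x, e) \<in> \<delta>"
    then have "block_rep x = block_rep e" by (rule block_rep_eq)
    also have "\<dots> = block_rep y" using block_rep_eq[OF block_rep_rel[OF y(1)]] y(2) by simp
    finally show "e = block_rep x" using y(2) by simp
  qed (use block_rep_rel[OF x] in simp)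
qed

lemma reps_carrier: "set reps \<subseteq> A"
  using \<delta>_carrier(2)[OF block_rep_rel] by (auto simp: reps_def)

lemma block_rep_in_reps: "x \<in> A \<Longrightarrow> block_rep x \<in> set reps"
  by (simp add: reps_def)

definition maps :: "('a \<Rightarrow> nat) list" where
  "maps = (SOME xs. set xs = affine_maps p)"

lemma set_maps [simp]: "set maps = affine_maps p"
  unfolding maps_def using finite_list[OF finite_affine_maps] by (rule someI_ex)

definition index :: "('a \<Rightarrow> nat) \<Rightarrow> nat" where
  "index \<chi> = (SOME i. i < length maps \<and> maps ! i = \<chi>)"

lemma index: "\<chi> \<in> affine_maps p \<Longrightarrow> index \<chi> < length maps \<and> maps ! index \<chi> = \<chi>"
proof -
  assume "\<chi> \<in> affine_maps p"
  then have "\<exists>i. i < length maps \<and> maps ! i = \<chi>" using set_maps by (metis in_set_conv_nth)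
  then show ?thesis unfolding index_def by (rule someI_ex)
qed

definition max_arity :: nat where
  "max_arity = sum_list (map fst ops)"

lemma max_arity: "k < length ops \<Longrightarrow> fst (ops ! k) \<le> max_arity"
  unfolding max_arity_def by (rule member_le_sum_list) auto

text \<open>An input contributes two runs of fewer than \<open>p\<close> copies. A gate contributes,
  for each tuple of blocks, a constant term of fewer than \<open>p\<close> copies and one entry per
  argument.\<close>

definition row_bound :: nat where
  "row_bound = 2 * p + Suc (length reps) ^ max_arity * (p + max_arity)"

end

section \<open>Three layers that refine the block bits of a circuit\<close>

locale circuit_run = elementary_interval A ops d \<delta> \<gamma> p
  for A :: "'a set" and ops d \<delta> \<gamma> p +
  fixes n :: nat and C :: "'a cnode list" and \<iota> :: "bool \<Rightarrow> 'a" and v :: "bool list \<Rightarrow> nat \<Rightarrow> 'a"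
  assumes wf: "circuit_wf A ops n C" and \<iota>: "range \<iota> \<subseteq> A" and run: "is_run ops n C \<iota> v"
begin

lemma v_closed: "\<lbrakk>length x = n; j < length C\<rbrakk> \<Longrightarrow> v x j \<in> A"
  by (rule run_closed[OF wf \<iota> run])

lemma gate_wf: "\<lbrakk>j < length C; C ! j = CGate k js\<rbrakk> \<Longrightarrow> k < length ops \<and> length js = fst (ops ! k) \<and> (\<forall>i\<in>set js. i < j)"
  using wf by (force simp: circuit_wf_def)

lemma length_cargs: "j < length C \<Longrightarrow> length (cargs (C ! j)) \<le> max_arity"
  using gate_wf max_arity by (cases "C ! j") auto

lemma cargs_less: "\<lbrakk>j < length C; s < length (cargs (C ! j))\<rbrakk> \<Longrightarrow> cargs (C ! j) ! s < j"
  using gate_wf by (cases "C ! j") auto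

abbreviation tuples :: "nat \<Rightarrow> 'a list list" where
  "tuples j \<equiv> List.n_lists (length (cargs (C ! j))) reps"

definition case_bit :: "nat \<Rightarrow> 'a list \<Rightarrow> bool list \<Rightarrow> bool" where
  "case_bit j es x \<longleftrightarrow> (\<forall>s < length (cargs (C ! j)). (v x (cargs (C ! j) ! s), es ! s) \<in> \<delta>)"

lemma tuples_mem: "es \<in> set (tuples j) \<Longrightarrow> length es = length (cargs (C ! j)) \<and> set es \<subseteq> set reps"
  by (simp add: set_n_lists)

lemma length_tuples: "j < length C \<Longrightarrow> length (tuples j) \<le> Suc (length reps) ^ max_arity"
  by (rule length_n_lists_le) (rule length_cargs)

text \<open>Elements of \<open>reps\<close> stand for distinct blocks, so on each input exactly one
  tuple is active. A sum over all tuples guarded by these bits is thus a case distinction.\<close>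

lemma case_bit_iff:
  assumes x: "length x = n" and j: "j < length C" and es: "es \<in> set (tuples j)"
  shows "case_bit j es x \<longleftrightarrow> es = map (\<lambda>i. block_rep (v x i)) (cargs (C ! j))"
proof -
  have "(v x (cargs (C ! j) ! s), es ! s) \<in> \<delta> \<longleftrightarrow> es ! s = block_rep (v x (cargs (C ! j) ! s))"
    if s: "s < length (cargs (C ! j))" for s
  proof (rule reps_rel)
    show "es ! s \<in> set reps" using tuples_mem[OF es] s by auto
    show "v x (cargs (C ! j) ! s) \<in> A" using v_closed[OF x] cargs_less[OF j s] j by simp
  qed
  then show ?thesis using tuples_mem[OF es] by (auto simp: case_bit_def list_eq_iff_nth_eq)
qed

definition layer1 :: "(bool list \<Rightarrow> bool) list" where
  "layer1 = state n (length C) v \<delta> @ concat (map (\<lambda>j. map (case_bit j) (tuples j)) [0..<length C])"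

lemma state_layer1: "set (state n (length C) v \<delta>) \<subseteq> set layer1"
  by (simp add: layer1_def)

lemma case_bit_layer1: "\<lbrakk>j < length C; es \<in> set (tuples j)\<rbrakk> \<Longrightarrow> case_bit j es \<in> set layer1"
  by (auto simp: layer1_def)

lemma p_gt_1: "p > 1" using prime prime_gt_1_nat by blast

text \<open>The bound \<open>Suc max_arity\<close> leaves room for the factors of a case bit and,
  even if all arities are 0, for the one factor of a copied bit.\<close>

lemma layer1_linear:
  assumes "g \<in> set layer1"
  shows "linear_bit p n (state n (length C) v \<delta>) (Suc max_arity) 1 g"
proof -
  consider "g \<in> set (state n (length C) v \<delta>)" | j es where "j < length C" "es \<in> set (tuples j)" "g = case_bit j es"
    using assms by (auto simp: layer1_def)
  then show ?thesis
  proof cases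
    case 1
    then show ?thesis using p_gt_1 by (intro linear_bit_mem) auto
  next
    case 2
    let ?fs = "map (\<lambda>s x. (v x (cargs (C ! j) ! s), es ! s) \<in> \<delta>) [0..<length (cargs (C ! j))]"
    show ?thesis
    proof (rule linear_bit_conj[where fs = ?fs])
      show "set ?fs \<subseteq> set (state n (length C) v \<delta>)"
      proof
        fix h assume "h \<in> set ?fs"
        then obtain s where s: "s < length (cargs (C ! j))" "h = (\<lambda>x. (v x (cargs (C ! j) ! s), es ! s) \<in> \<delta>)"
          by auto
        moreover have "cargs (C ! j) ! s < length C" using cargs_less[OF 2(1) s(1)] 2(1) by simp
        moreover have "es ! s \<in> A" using tuples_mem[OF 2(2)] s(1) reps_carrier nth_mem by fastforce
        ultimately show "h \<in> set (state n (length C) v \<delta>)" unfolding set_state by blast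
      qed
      show "length ?fs \<le> Suc max_arity" using length_cargs[OF 2(1)] by simp
      show "g x \<longleftrightarrow> (\<forall>f\<in>set ?fs. f x)" for x by (auto simp: 2(3) case_bit_def)
    qed (use p_gt_1 in auto)
  qed
qed

lemma length_layer1:
  assumes "n \<le> K" and "length C \<le> K"
  shows "length layer1 \<le> 1 + 2 * K + K * length elems + K * Suc (length reps) ^ max_arity"
proof -
  have "length (concat (map (\<lambda>j. map (case_bit j) (tuples j)) [0..<length C]))
      \<le> length [0..<length C] * Suc (length reps) ^ max_arity"
    by (rule length_concat_map_le) (use length_tuples in auto)
  also have "\<dots> \<le> K * Suc (length reps) ^ max_arity" using assms by (intro mult_le_mono) auto
  finally show ?thesis using length_state_le[OF assms, of v \<delta>] by (simp add: layer1_def)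
qed

text \<open>The right-hand side of the equation for the unknown \<open>\<chi> (v x j)\<close>; at a
  gate, one affine expansion per tuple of blocks, guarded by its \<open>case_bit\<close>.
  Coefficients are encoded by repetition, and reducing the constant term modulo \<open>p\<close>
  bounds the length.\<close>

definition row :: "nat \<Rightarrow> ('a \<Rightarrow> nat) \<Rightarrow> (nat \<times> (bool list \<Rightarrow> bool)) list" where
  "row j \<chi> = (case C ! j of
      CIn q \<Rightarrow> replicate (\<chi> (\<iota> True)) (0, \<lambda>x. x ! q) @ replicate (\<chi> (\<iota> False)) (0, \<lambda>x. \<not> x ! q)
    | CConst a \<Rightarrow> replicate (\<chi> a) (0, \<lambda>x. True)
    | CGate k js \<Rightarrow> concat (map (\<lambda>es.
        replicate ((1 + (p - 1) * length es) * \<chi> (snd (ops ! k) es) mod p) (0, case_bit j es) @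
        map (\<lambda>s. (1 + js ! s * length maps + index (shift \<chi> k es s), case_bit j es)) [0..<length js])
        (tuples j)))"

text \<open>Variable 0 is the constant one. The unknown for node \<open>j\<close> and map number
  \<open>i\<close> is variable \<open>1 + j * length maps + i\<close>, so the unknowns of a node
  come after those of its arguments.\<close>

definition var :: "bool list \<Rightarrow> nat \<Rightarrow> nat" where
  "var x t = (if t = 0 then 1 else (maps ! ((t - 1) mod length maps)) (v x ((t - 1) div length maps)))"

lemma var_0: "var x 0 = 1"
  by (simp add: var_def)

lemma var_Suc: "i < length maps \<Longrightarrow> var x (1 + j * length maps + i) = (maps ! i) (v x j)"
proof -
  assume "i < length maps"
  then have "(i + j * length maps) div length maps = j" by (subst div_mult_self1) auto
  then have "(j * length maps + i) div length maps = j" by (simp only: add.commute)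
  then show ?thesis using \<open>i < length maps\<close> by (simp add: var_def)
qed

text \<open>At a gate, \<open>case_bit_iff\<close> leaves only the tuple of the actual block
  representatives in the sum. For that tuple the row spells out \<open>affine_expansion\<close>,
  with each shifted map replaced by its unknown at the argument.\<close>

lemma row_correct:
  assumes x: "length x = n" and j: "j < length C" and \<chi>: "\<chi> \<in> affine_maps p"
  shows "[\<chi> (v x j) = (\<Sum>(u, f)\<leftarrow>row j \<chi>. if f x then var x u else 0)] (mod p)"
proof -
  have vj: "v x j = (case C ! j of CIn q \<Rightarrow> \<iota> (x ! q) | CConst a \<Rightarrow> a | CGate k js \<Rightarrow> snd (ops ! k) (map (v x) js))"
    using run x j by (simp add: is_run_def)
  show ?thesis
  proof (cases "C ! j")
    case (CIn q)
    then show ?thesis using vj by (cases "x ! q") (simp_all add: row_def sum_list_replicate var_0)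
  next
    case (CConst a)
    then show ?thesis using vj by (simp add: row_def sum_list_replicate var_0)
  next
    case (CGate k js)
    note gw = gate_wf[OF j CGate]
    have ca: "cargs (C ! j) = js" using CGate by simp
    let ?f = "snd (ops ! k)"
    let ?coef = "\<lambda>es. (1 + (p - 1) * length es) * \<chi> (?f es) mod p"
    let ?e = "map (\<lambda>i. block_rep (v x i)) js"
    have vA: "v x i \<in> A" if "i \<in> set js" for i using v_closed[OF x] gw that j by fastforce
    have e_mem: "?e \<in> set (tuples j)"
      using vA block_rep_in_reps unfolding ca by (auto simp: set_n_lists)
    have eA: "set ?e \<subseteq> A" using tuples_mem[OF e_mem] reps_carrier by blast
    let ?g = "\<lambda>es. if case_bit j es x then ?coef es +
        (\<Sum>s\<leftarrow>[0..<length js]. var x (1 + js ! s * length maps + index (shift \<chi> k es s))) else 0"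
    have "(\<Sum>(u, f)\<leftarrow>row j \<chi>. if f x then var x u else 0) = sum_list (map ?g (tuples j))"
      unfolding row_def CGate cnode.case map_concat sum_list_concat_map map_map
      by (rule arg_cong[of _ _ sum_list], rule map_cong) (auto simp: sum_list_replicate var_0 comp_def)
    also have "\<dots> = ?g ?e"
    proof (rule sum_list_single)
      show "distinct (tuples j)" by (rule distinct_n_lists) (simp add: reps_def)
      show "?g es = 0" if "es \<in> set (tuples j)" "es \<noteq> ?e" for es
        using case_bit_iff[OF x j that(1)] that(2) ca by simp
    qed (rule e_mem)
    also have "\<dots> = ?coef ?e + (\<Sum>s\<leftarrow>[0..<length js]. var x (1 + js ! s * length maps + index (shift \<chi> k ?e s)))"
      using case_bit_iff[OF x j e_mem] ca by simp
    also have "(\<Sum>s\<leftarrow>[0..<length js]. var x (1 + js ! s * length maps + index (shift \<chi> k ?e s))) =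
        (\<Sum>s<length js. shift \<chi> k ?e s (v x (js ! s)))"
    proof -
      have "var x (1 + js ! s * length maps + index (shift \<chi> k ?e s)) = shift \<chi> k ?e s (v x (js ! s))"
        if "s < length js" for s
      proof -
        have "shift \<chi> k ?e s \<in> affine_maps p"
          using p_gt_1 gw that eA by (intro shift_affine[OF \<chi>]) auto
        then show ?thesis using index var_Suc by metis
      qed
      then show ?thesis by (simp add: interv_sum_list_conv_sum_set_nat lessThan_atLeast0 cong: map_cong)
    qed
    finally have sum: "(\<Sum>(u, f)\<leftarrow>row j \<chi>. if f x then var x u else 0) =
        ?coef ?e + (\<Sum>s<length js. shift \<chi> k ?e s (v x (js ! s)))" .
    have "[\<chi> (?f (map (v x) js)) = (1 + (p - 1) * length ?e) * \<chi> (?f ?e)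
        + (\<Sum>s<length ?e. shift \<chi> k ?e s (map (v x) js ! s))] (mod p)"
      by (rule affine_expansion[OF \<chi>]) (use p_gt_1 gw vA block_rep_rel in auto)
    then have "[\<chi> (v x j) = (1 + (p - 1) * length ?e) * \<chi> (?f ?e)
        + (\<Sum>s<length js. shift \<chi> k ?e s (v x (js ! s)))] (mod p)"
      using vj CGate by simp
    then show ?thesis unfolding sum by (simp add: cong_def mod_add_left_eq)
  qed
qed

text \<open>This is triangularity: the unknowns of node \<open>j\<close> start at index
  \<open>1 + j * length maps\<close>, and those of an earlier node end at
  \<open>j * length maps\<close> or before.\<close>

lemma row_bits:
  assumes j: "j < length C" and \<chi>: "\<chi> \<in> affine_maps p" and uf: "(u, f) \<in> set (row j \<chi>)"
  shows "u \<le> j * length maps \<and> f \<in> set layer1"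
proof (cases "C ! j")
  case (CIn q)
  then have "q < n" using wf j by (force simp: circuit_wf_def)
  then have "(\<lambda>x. x ! q) \<in> set (state n (length C) v \<delta>)" "(\<lambda>x. \<not> x ! q) \<in> set (state n (length C) v \<delta>)"
    unfolding set_state by blast+
  then show ?thesis using uf CIn state_layer1 by (auto simp: row_def)
next
  case (CConst a)
  have "(\<lambda>x. True) \<in> set (state n (length C) v \<delta>)" unfolding set_state by blast
  then show ?thesis using uf CConst state_layer1 by (auto simp: row_def)
next
  case (CGate k js)
  note gw = gate_wf[OF j CGate]
  have ca: "cargs (C ! j) = js" using CGate by simp
  obtain zs where "zs \<in> set (map (\<lambda>es.
        replicate ((1 + (p - 1) * length es) * \<chi> (snd (ops ! k) es) mod p) (0, case_bit j es) @
        map (\<lambda>s. (1 + js ! s * length maps + index (shift \<chi> k es s), case_bit j es)) [0..<length js])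
        (tuples j))" and "(u, f) \<in> set zs"
    using uf unfolding row_def CGate cnode.case set_concat by blast
  then obtain es where es: "es \<in> set (tuples j)"
    and "(u, f) \<in> set (replicate ((1 + (p - 1) * length es) * \<chi> (snd (ops ! k) es) mod p) (0, case_bit j es) @
        map (\<lambda>s. (1 + js ! s * length maps + index (shift \<chi> k es s), case_bit j es)) [0..<length js])"
    unfolding set_map by blast
  then have cases: "u = 0 \<or> (\<exists>s<length js. u = 1 + js ! s * length maps + index (shift \<chi> k es s))"
    and f: "f = case_bit j es"
    by (auto simp: in_set_replicate)
  have "u \<le> j * length maps"
    using cases
  proof
    assume "\<exists>s<length js. u = 1 + js ! s * length maps + index (shift \<chi> k es s)"
    then obtain s where s: "s < length js" "u = 1 + js ! s * length maps + index (shift \<chi> k es s)" by blast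
    have "shift \<chi> k es s \<in> affine_maps p"
      using p_gt_1 gw tuples_mem[OF es] reps_carrier s ca by (intro shift_affine[OF \<chi>]) auto
    then have "u \<le> Suc (js ! s) * length maps" using index s(2) by fastforce
    also have "\<dots> \<le> j * length maps" using gw nth_mem[OF s(1)] by (intro mult_le_mono1) (simp add: Suc_le_eq)
    finally show ?thesis .
  qed simp
  then show ?thesis using f case_bit_layer1[OF j es] by simp
qed

lemma length_row:
  assumes j: "j < length C" and \<chi>: "\<chi> \<in> affine_maps p"
  shows "length (row j \<chi>) \<le> row_bound"
proof (cases "C ! j")
  case (CIn q)
  have "\<chi> (\<iota> b) < p" for b using affine_mapsD(1)[OF \<chi>] \<iota> by blast
  from this[of True] this[of False] show ?thesis using CIn by (simp add: row_def row_bound_def)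
next
  case (CConst a)
  then have "a \<in> A" using wf j by (force simp: circuit_wf_def)
  then have "\<chi> a < p" using affine_mapsD(1)[OF \<chi>] by blast
  then show ?thesis using CConst by (simp add: row_def row_bound_def)
next
  case (CGate k js)
  have ca: "cargs (C ! j) = js" using CGate by simp
  have js: "length js \<le> max_arity" using length_cargs[OF j] ca by simp
  have "length (row j \<chi>) \<le> length (tuples j) * (p + max_arity)"
    unfolding row_def CGate cnode.case
  proof (rule length_concat_map_le)
    fix es
    have "(1 + (p - 1) * length es) * \<chi> (snd (ops ! k) es) mod p \<le> p"
      using p_gt_1 by (intro less_imp_le mod_less_divisor) simp
    then show "length (replicate ((1 + (p - 1) * length es) * \<chi> (snd (ops ! k) es) mod p) (0, case_bit j es) @
        map (\<lambda>s. (1 + js ! s * length maps + index (shift \<chi> k es s), case_bit j es)) [0..<length js]) \<le> p + max_arity"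
      using js by (simp only: length_append length_replicate length_map length_upt)
  qed
  also have "\<dots> \<le> Suc (length reps) ^ max_arity * (p + max_arity)"
    using length_tuples[OF j] by (rule mult_le_mono1)
  finally show ?thesis by (simp add: row_bound_def)
qed

definition value_bits :: "nat \<Rightarrow> (bool list \<Rightarrow> bool) list" where
  "value_bits j = concat (map (\<lambda>\<chi>. map (\<lambda>c x. \<chi> (v x j) = c) [0..<p]) maps)"

definition layer2 :: "(bool list \<Rightarrow> bool) list" where
  "layer2 = state n (length C) v \<delta> @ concat (map value_bits [0..<length C])"

lemma state_layer2: "set (state n (length C) v \<delta>) \<subseteq> set layer2"
  by (simp add: layer2_def)

lemma value_layer2: "\<lbrakk>j < length C; \<chi> \<in> affine_maps p; c < p\<rbrakk> \<Longrightarrow> (\<lambda>x. \<chi> (v x j) = c) \<in> set layer2"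
proof -
  assume j: "j < length C" and \<chi>: "\<chi> \<in> affine_maps p" and c: "c < p"
  let ?h = "\<lambda>\<chi>. map (\<lambda>c x. \<chi> (v x j) = c) [0..<p]"
  have "(\<lambda>x. \<chi> (v x j) = c) \<in> set (?h \<chi>)"
    unfolding set_map using c by (intro imageI) simp
  moreover have "?h \<chi> \<in> set (map ?h maps)"
    unfolding set_map set_maps using \<chi> by (rule imageI)
  ultimately have "(\<lambda>x. \<chi> (v x j) = c) \<in> set (value_bits j)"
    unfolding value_bits_def set_concat by blast
  moreover have "value_bits j \<in> set (map value_bits [0..<length C])" using j by simp
  ultimately show ?thesis unfolding layer2_def set_append set_concat by blast
qed

text \<open>A gate tests only its last variable, so the system is cut off at the unknown in
  question, and each unknown and residue get a gate of their own. Values of affine maps on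
  \<open>A\<close> are below \<open>p\<close>, so comparing residues compares values.\<close>

lemma value_linear:
  assumes j: "j < length C" and \<chi>: "\<chi> \<in> affine_maps p"
    and K: "length C \<le> K"
  shows "linear_bit p n layer1 (Suc (K * length maps)) (Suc row_bound) (\<lambda>x. \<chi> (v x j) = c)"
proof -
  let ?B = "length maps"
  let ?t = "1 + j * ?B + index \<chi>"
  let ?R = "\<lambda>t. row ((t - 1) div ?B) (maps ! ((t - 1) mod ?B))"
  note ix = index[OF \<chi>]
  have B: "?B > 0" using ix by linarith
  have less: "j * ?B + index \<chi> < length C * ?B"
  proof -
    have "j * ?B + index \<chi> < Suc j * ?B" using ix by simp
    also have "\<dots> \<le> length C * ?B" using j by (intro mult_le_mono1) auto
    finally show ?thesis .
  qed
  have t: "(t - 1) div ?B < length C" "maps ! ((t - 1) mod ?B) \<in> affine_maps p" if "1 \<le> t" "t \<le> ?t" for t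
  proof -
    have "t - 1 < length C * ?B" using that less by simp
    then show "(t - 1) div ?B < length C" by (rule less_mult_imp_div_less)
    have "(t - 1) mod ?B < ?B" using B by simp
    then show "maps ! ((t - 1) mod ?B) \<in> affine_maps p" using nth_mem set_maps by metis
  qed
  show ?thesis
  proof (rule linear_bitI[where k = ?t and R = ?R and W = var and T = "{c}"])
    have "length C * ?B \<le> K * ?B" using K by (rule mult_le_mono1)
    then show "?t \<le> Suc (K * ?B)" using less by linarith
    show "length (?R t) \<le> Suc row_bound" if "1 \<le> t" "t \<le> ?t" for t
      using length_row[OF t[OF that]] by simp
    show "u < t \<and> f \<in> set layer1" if ht: "1 \<le> t" "t \<le> ?t" and "(u, f) \<in> set (?R t)" for t u f
    proof -
      have "u \<le> (t - 1) div ?B * ?B" "f \<in> set layer1" using row_bits[OF t[OF ht] that(3)] by auto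
      moreover have "(t - 1) div ?B * ?B \<le> t - 1" by simp
      ultimately show ?thesis using ht(1) by linarith
    qed
    show "[var x 0 = 1] (mod p)" for x by (simp add: var_0)
    show "[var x t = (\<Sum>(u, f)\<leftarrow>?R t. if f x then var x u else 0)] (mod p)"
      if x: "length x = n" and ht: "1 \<le> t" "t \<le> ?t" for x t
      using row_correct[OF x t[OF ht]] ht(1) by (simp add: var_def)
    show "\<chi> (v x j) = c \<longleftrightarrow> var x ?t mod p \<in> {c}" if x: "length x = n" for x
    proof -
      have "var x ?t = \<chi> (v x j)" using ix var_Suc by metis
      moreover have "\<chi> (v x j) < p" using affine_mapsD(1)[OF \<chi>] v_closed[OF x j] by blast
      ultimately show ?thesis by simp
    qed
  qed
qed

lemma layer2_linear:
  assumes "g \<in> set layer2" and "length C \<le> K"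
  shows "linear_bit p n layer1 (Suc (K * length maps)) (Suc row_bound) g"
proof -
  consider "g \<in> set (state n (length C) v \<delta>)"
    | j \<chi> c where "j < length C" "\<chi> \<in> affine_maps p" "g = (\<lambda>x. \<chi> (v x j) = c)"
    using assms(1) by (auto simp: layer2_def value_bits_def)
  then show ?thesis
  proof cases
    case 1
    then show ?thesis using p_gt_1 state_layer1 by (intro linear_bit_mem) auto
  qed (use value_linear assms(2) in auto)
qed

lemma length_layer2:
  assumes "n \<le> K" and "length C \<le> K"
  shows "length layer2 \<le> 1 + 2 * K + K * length elems + K * (length maps * p)"
proof -
  have "length (value_bits j) \<le> length maps * p" for j
    unfolding value_bits_def by (rule length_concat_map_le) simp
  then have "length (concat (map value_bits [0..<length C])) \<le> length [0..<length C] * (length maps * p)"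
    by (intro length_concat_map_le)
  also have "\<dots> \<le> K * (length maps * p)" using assms by (intro mult_le_mono) auto
  finally show ?thesis using length_state_le[OF assms, of v \<delta>] by (simp add: layer2_def)
qed

text \<open>Within a \<delta>-block, two elements are congruent modulo \<gamma> exactly when no
  affine map separates them. As \<open>\<chi> a\<close> is a known constant, each new bit is a
  conjunction of one block bit and one value bit per map.\<close>

lemma state_linear:
  assumes "g \<in> set (state n (length C) v \<gamma>)"
  shows "linear_bit p n layer2 (Suc (length maps)) 1 g"
  using assms
proof (cases rule: stateE)
  case 1
  then show ?thesis using p_gt_1 by (intro linear_bit_conj[where fs = "[]"]) auto
next
  case (2 q)
  then have "g \<in> set (state n (length C) v \<delta>)" unfolding set_state by blast
  then show ?thesis using p_gt_1 state_layer2 by (intro linear_bit_mem) auto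
next
  case (3 q)
  then have "g \<in> set (state n (length C) v \<delta>)" unfolding set_state by blast
  then show ?thesis using p_gt_1 state_layer2 by (intro linear_bit_mem) auto
next
  case (4 j a)
  let ?fs = "(\<lambda>x. (v x j, a) \<in> \<delta>) # map (\<lambda>\<chi> x. \<chi> (v x j) = \<chi> a) maps"
  show ?thesis
  proof (rule linear_bit_conj[where fs = ?fs])
    have "(\<lambda>x. (v x j, a) \<in> \<delta>) \<in> set (state n (length C) v \<delta>)"
      using 4 unfolding set_state by blast
    moreover have "(\<lambda>x. \<chi> (v x j) = \<chi> a) \<in> set layer2" if "\<chi> \<in> affine_maps p" for \<chi>
      using value_layer2[OF 4(1) that affine_mapsD(1)[OF that 4(2)]] .
    ultimately show "set ?fs \<subseteq> set layer2" using state_layer2 by auto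
    show "g x \<longleftrightarrow> (\<forall>f\<in>set ?fs. f x)" if "length x = n" for x
    proof -
      have "(v x j, a) \<in> \<gamma> \<longleftrightarrow> (v x j, a) \<in> \<delta> \<and> (\<forall>\<chi>\<in>affine_maps p. \<chi> (v x j) = \<chi> a)"
      proof
        assume "(v x j, a) \<in> \<gamma>"
        then show "(v x j, a) \<in> \<delta> \<and> (\<forall>\<chi>\<in>affine_maps p. \<chi> (v x j) = \<chi> a)"
          using le affine_mapsD(2) by auto
      next
        assume r: "(v x j, a) \<in> \<delta> \<and> (\<forall>\<chi>\<in>affine_maps p. \<chi> (v x j) = \<chi> a)"
        show "(v x j, a) \<in> \<gamma>"
        proof (rule ccontr)
          assume "(v x j, a) \<notin> \<gamma>"
          then obtain \<chi> where "\<chi> \<in> affine_maps p" "\<chi> (v x j) \<noteq> \<chi> a"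
            by (rule affine_maps_separate[OF prime elementary conjunct1[OF r]])
          then show False using r by simp
        qed
      qed
      then show ?thesis using 4(3) by simp
    qed
  qed (use p_gt_1 in auto)
qed

end

context elementary_interval
begin

lemma resolvable_step:
  assumes "resolvable \<delta>"
  shows "resolvable \<gamma>"
proof -
  obtain ps f where ps: "\<forall>p\<in>set ps. prime p" and f: "poly_bounded f"
    and comp: "\<And>n C \<iota> v K. \<lbrakk>circuit_wf A ops n C; range \<iota> \<subseteq> A; is_run ops n C \<iota> v; n \<le> K; length C \<le> K\<rbrakk>
        \<Longrightarrow> computable ps n (f K) (state n (length C) v \<delta>)"
    using assms unfolding resolvable_def by metis
  \<comment> \<open>\<open>?s\<close>, \<open>?s1\<close> and \<open>?s2\<close> bound the widths of
    the layers. Each of \<open>?f1\<close>, \<open>?f2\<close>, \<open>?f3\<close> adds one layer: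
    the number of its gates times the width below plus \<open>2 * N + 1 + N * M\<close>, with
    \<open>N\<close> and \<open>M\<close> as in \<open>layer1_linear\<close>,
    \<open>layer2_linear\<close> and \<open>state_linear\<close>.\<close>
  let ?s = "\<lambda>K. 1 + 2 * K + K * length elems"
  let ?s1 = "\<lambda>K. 1 + 2 * K + K * length elems + K * Suc (length reps) ^ max_arity"
  let ?s2 = "\<lambda>K. 1 + 2 * K + K * length elems + K * (length maps * p)"
  let ?f1 = "\<lambda>K. f K + ?s1 K * (?s K + 2 * Suc max_arity + 1 + Suc max_arity * 1)"
  let ?f2 = "\<lambda>K. ?f1 K + ?s2 K * (?s1 K + 2 * Suc (K * length maps) + 1 + Suc (K * length maps) * Suc row_bound)"
  let ?f3 = "\<lambda>K. ?f2 K + ?s K * (?s2 K + 2 * Suc (length maps) + 1 + Suc (length maps) * 1)"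
  have "computable (p # p # p # ps) n (?f3 K) (state n (length C) v \<gamma>)"
    if hyp: "circuit_wf A ops n C" "range \<iota> \<subseteq> A" "is_run ops n C \<iota> v" and K: "n \<le> K" "length C \<le> K"
    for n C \<iota> v K
  proof -
    interpret circuit_run A ops d \<delta> \<gamma> p n C \<iota> v by unfold_locales (fact hyp)+
    have "computable (p # ps) n (?f1 K) layer1"
      by (rule computable_layer_le[OF prime comp[OF hyp K]]; intro layer1_linear length_state_le length_layer1 K)
    then have "computable (p # p # ps) n (?f2 K) layer2"
      by (rule computable_layer_le[OF prime]; intro layer2_linear length_layer1 length_layer2 K)
    then show ?thesis
      by (rule computable_layer_le[OF prime]; intro state_linear length_layer2 length_state_le K)
  qed
  moreover have "poly_bounded ?f3"
    unfolding Suc_eq_plus1 by (intro poly_bounded_intros f)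
  moreover have "\<forall>q\<in>set (p # p # p # ps). prime q" using ps prime by simp
  ultimately show ?thesis unfolding resolvable_def by (intro exI[of _ "p # p # p # ps"] exI[of _ ?f3]) blast
qed

end

subsection \<open>The derived series\<close>

text \<open>\<delta> itself belongs to the family that is intersected, so the intersection lies
  below \<delta>. The term condition survives intersections: its premise for the intersection yields
  the premise for every member, and the conclusions are collected again.\<close>

lemma commutator_self:
  fixes A :: "'a set"
  assumes \<delta>: "is_cong A ops \<delta>" and alg: "malcev_algebra A ops d"
  shows "is_cong A ops (commutator A ops \<delta> \<delta>)" and "centralizes ops \<delta> \<delta> (commutator A ops \<delta> \<delta>)"
    and "commutator A ops \<delta> \<delta> \<subseteq> \<delta>"
proof -
  interpret malcev_algebra A ops d by fact
  let ?\<Gamma> = "{\<gamma>. is_cong A ops \<gamma> \<and> centralizes ops \<delta> \<delta> \<gamma>}"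
  have comp: "compatible ops \<delta>" using \<delta> by (simp add: is_cong_iff)
  have "centralizes ops \<delta> \<delta> \<delta>"
    unfolding centralizes_def
  proof (intro allI impI)
    fix t :: "(nat + nat) trm" and f f' g g' :: "nat \<Rightarrow> 'a"
    assume "twf ops t" and rel: "\<forall>i. (f i, f' i) \<in> \<delta>" "\<forall>j. (g j, g' j) \<in> \<delta>"
    moreover have "(f' i, f' i) \<in> \<delta>" for i
      using is_cong_refl[OF \<delta>] is_cong_carrier[OF \<delta> rel(1)[rule_format]] by blast
    ultimately show "(teval ops (case_sum f' g) t, teval ops (case_sum f' g') t) \<in> \<delta>"
      by (intro teval_compatible[OF comp]) (auto split: sum.splits)
  qed
  then have mem: "\<delta> \<in> ?\<Gamma>" using \<delta> by simp
  then show sub: "commutator A ops \<delta> \<delta> \<subseteq> \<delta>" unfolding commutator_def by blast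
  show "is_cong A ops (commutator A ops \<delta> \<delta>)"
  proof (rule reflexive_compatible_is_cong)
    show "commutator A ops \<delta> \<delta> \<subseteq> A \<times> A" using sub is_cong_carrier[OF \<delta>] by auto
    show "(a, a) \<in> commutator A ops \<delta> \<delta>" if "a \<in> A" for a
      using that is_cong_refl unfolding commutator_def by blast
    show "compatible ops (commutator A ops \<delta> \<delta>)"
      unfolding compatible_def
    proof (intro allI impI)
      fix k xs ys
      assume k: "k < length ops" and xy: "length xs = fst (ops ! k) \<and> length ys = length xs \<and>
        (\<forall>i<length xs. (xs ! i, ys ! i) \<in> commutator A ops \<delta> \<delta>)"
      have "(snd (ops ! k) xs, snd (ops ! k) ys) \<in> \<gamma>" if "\<gamma> \<in> ?\<Gamma>" for \<gamma>
      proof -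
        have "\<forall>i<length xs. (xs ! i, ys ! i) \<in> \<gamma>" using xy that unfolding commutator_def by blast
        moreover have "compatible ops \<gamma>" using that by (simp add: is_cong_iff)
        ultimately show ?thesis using k xy by (simp add: compatible_def)
      qed
      then show "(snd (ops ! k) xs, snd (ops ! k) ys) \<in> commutator A ops \<delta> \<delta>"
        unfolding commutator_def by blast
    qed
  qed
  show "centralizes ops \<delta> \<delta> (commutator A ops \<delta> \<delta>)"
    unfolding centralizes_def
  proof (intro allI impI)
    fix t :: "(nat + nat) trm" and f f' g g' :: "nat \<Rightarrow> 'a"
    assume t: "twf ops t" and rel: "\<forall>i. (f i, f' i) \<in> \<delta>" "\<forall>j. (g j, g' j) \<in> \<delta>"
      and r: "(teval ops (case_sum f g) t, teval ops (case_sum f g') t) \<in> commutator A ops \<delta> \<delta>"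
    have "(teval ops (case_sum f' g) t, teval ops (case_sum f' g') t) \<in> \<gamma>" if "\<gamma> \<in> ?\<Gamma>" for \<gamma>
    proof -
      have c: "centralizes ops \<delta> \<delta> \<gamma>" using that by simp
      have "(teval ops (case_sum f g) t, teval ops (case_sum f g') t) \<in> \<gamma>"
        using r that unfolding commutator_def by blast
      then show ?thesis using c[unfolded centralizes_def] t rel by blast
    qed
    then show "(teval ops (case_sum f' g) t, teval ops (case_sum f' g') t) \<in> commutator A ops \<delta> \<delta>"
      unfolding commutator_def by blast
  qed
qed

context malcev_algebra
begin

text \<open>Split off the elements of prime order \<open>p\<close> of the group of each block modulo \<open>\<gamma>\<close>: they form a
  congruence strictly above \<open>\<gamma>\<close>.\<close>

lemma resolvable_abelian:
  assumes \<delta>: "is_cong A ops \<delta>" and res: "resolvable \<delta>"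
    and "is_cong A ops \<gamma>" and "\<gamma> \<subseteq> \<delta>" and "abelian_over \<delta> \<gamma>"
  shows "resolvable \<gamma>"
  using assms(3-5)
proof (induction "card (\<delta> - \<gamma>)" arbitrary: \<gamma> rule: less_induct)
  case less
  show ?case
  proof (cases "\<gamma> = \<delta>")
    case True
    then show ?thesis using res by simp
  next
    case False
    interpret I: abelian_interval A ops d \<delta> \<gamma> by unfold_locales (fact \<delta> less.prems)+
    obtain p where p: "prime p" "\<gamma> \<subset> I.torsion p" using I.exists_torsion[OF False] .
    have "\<delta> \<subseteq> A \<times> A" using is_cong_carrier[OF \<delta>] by auto
    then have "finite (\<delta> - \<gamma>)" using finite_A by (meson finite_Diff finite_SigmaI finite_subset)
    then have "card (\<delta> - I.torsion p) < card (\<delta> - \<gamma>)"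
      using p(2) I.torsion_le[of p] by (intro psubset_card_mono) auto
    \<comment> \<open>The torsion congruence is strictly nearer to \<delta> than \<gamma> is, so the
      induction hypothesis applies to it. What remains is the interval from it down to \<gamma>,
      which is elementary.\<close>
    then have tors: "resolvable (I.torsion p)"
      using I.torsion_is_cong I.torsion_le less.prems(3) p(2)
      by (intro less.hyps) (auto intro: abelian_over_mono)
    interpret J: abelian_interval A ops d "I.torsion p" \<gamma>
      by unfold_locales
        (use I.torsion_is_cong less.prems p(2) abelian_over_mono[OF less.prems(3) I.torsion_le order_refl] in auto)
    interpret J: elementary_interval A ops d "I.torsion p" \<gamma> p
    proof unfold_locales
      \<comment> \<open>Multiples do not depend on the upper congruence, so pairs killed by
        \<open>p\<close> inside \<delta> are killed by \<open>p\<close> inside the smaller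
        interval.\<close>
      show "I.torsion p \<subseteq> J.torsion p" unfolding J.torsion_def by (auto simp: I.torsion_def)
    qed (fact p(1))
    show ?thesis using tors by (rule J.resolvable_step)
  qed
qed

lemma resolvable_derived: "is_cong A ops (derived A ops k) \<and> resolvable (derived A ops k)"
proof (induction k)
  case 0
  have "compatible ops (A \<times> A)"
    unfolding compatible_def
  proof (intro allI impI, elim conjE)
    fix k xs ys
    assume k: "k < length ops" and len: "length xs = fst (ops ! k)" "length ys = length xs"
      and rel: "\<forall>i<length xs. (xs ! i, ys ! i) \<in> A \<times> A"
    then have "set xs \<subseteq> A" "set ys \<subseteq> A" by (metis in_set_conv_nth mem_Sigma_iff subsetI)+
    then show "(snd (ops ! k) xs, snd (ops ! k) ys) \<in> A \<times> A" using op_closed[OF k] len by simp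
  qed
  then have "is_cong A ops (A \<times> A)" by (intro reflexive_compatible_is_cong) auto
  then show ?case using resolvable_full by simp
next
  case (Suc k)
  note step = commutator_self[OF conjunct1[OF Suc] malcev_algebra_axioms]
  have "resolvable (commutator A ops (derived A ops k) (derived A ops k))"
    by (rule resolvable_abelian[OF conjunct1[OF Suc] conjunct2[OF Suc] step(1,3)
          centralizes_imp_abelian_over[OF conjunct1[OF Suc] step(1,2)]])
  then show ?case using step(1) by simp
qed

end

section \<open>From NuDFAs to the layered class\<close>

lemma foldl_node_val:
  assumes "vs = foldl (\<lambda>vs g. vs @ [node_val ops x vs g]) [] C"
  shows "length vs = length C \<and> (\<forall>j<length C. vs ! j = node_val ops x (take j vs) (C ! j))"
  using assms
proof (induction C arbitrary: vs rule: rev_induct)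
  case (snoc g C)
  define us where "us = foldl (\<lambda>vs g. vs @ [node_val ops x vs g]) [] C"
  then have "length us = length C" "\<And>j. j < length C \<Longrightarrow> us ! j = node_val ops x (take j us) (C ! j)"
    using snoc.IH by blast+
  moreover have "vs = us @ [node_val ops x us g]" using snoc.prems us_def by simp
  ultimately show ?case by (auto simp: nth_append less_Suc_eq)
qed simp

definition circuit_vals :: "'a ops \<Rightarrow> 'a cnode list \<Rightarrow> (bool \<Rightarrow> 'a) \<Rightarrow> bool list \<Rightarrow> nat \<Rightarrow> 'a" where
  "circuit_vals ops C \<iota> x j = foldl (\<lambda>vs g. vs @ [node_val ops (map \<iota> x) vs g]) [] C ! j"

lemma circuit_eval_conv:
  assumes "C \<noteq> []"
  shows "circuit_eval ops C (map \<iota> x) = circuit_vals ops C \<iota> x (length C - 1)"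
proof -
  let ?vs = "foldl (\<lambda>vs g. vs @ [node_val ops (map \<iota> x) vs g]) [] C"
  have "length ?vs = length C" using foldl_node_val by blast
  moreover from this have "?vs \<noteq> []" using assms by (metis length_0_conv)
  ultimately show ?thesis using last_conv_nth[of ?vs] by (simp add: circuit_eval_def circuit_vals_def)
qed

lemma is_run_circuit_vals:
  assumes wf: "circuit_wf A ops n C"
  shows "is_run ops n C \<iota> (circuit_vals ops C \<iota>)"
  unfolding is_run_def
proof (intro allI impI)
  fix x :: "bool list" and j assume x: "length x = n" and j: "j < length C"
  define vs where "vs = foldl (\<lambda>vs g. vs @ [node_val ops (map \<iota> x) vs g]) [] C"
  have vs: "circuit_vals ops C \<iota> x i = vs ! i" for i by (simp add: circuit_vals_def vs_def)
  have vj: "vs ! j = node_val ops (map \<iota> x) (take j vs) (C ! j)"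
    using foldl_node_val[OF vs_def] j by blast
  have wfj: "case C ! j of CIn q \<Rightarrow> q < n | CConst a \<Rightarrow> a \<in> A
      | CGate k js \<Rightarrow> k < length ops \<and> length js = fst (ops ! k) \<and> (\<forall>i\<in>set js. i < j)"
    using wf j by (auto simp: circuit_wf_def)
  show "circuit_vals ops C \<iota> x j = (case C ! j of CIn q \<Rightarrow> \<iota> (x ! q) | CConst a \<Rightarrow> a
      | CGate k js \<Rightarrow> snd (ops ! k) (map (circuit_vals ops C \<iota> x) js))"
  proof (cases "C ! j")
    case (CGate k js)
    then have args: "map ((!) (take j vs)) js = map (circuit_vals ops C \<iota> x) js"
      using wfj vs by auto
    have "circuit_vals ops C \<iota> x j = snd (ops ! k) (map ((!) (take j vs)) js)"
      using vj vs CGate by simp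
    then show ?thesis unfolding args CGate by simp
  qed (use vj vs wfj x in auto)
qed

text \<open>For positive \<open>n\<close> one has \<open>Suc n \<le> 2 * n\<close>, and the additive
  constant takes care of \<open>n = 0\<close>. This is the shape of bound that \<open>nuDet\<close>
  asks for.\<close>

lemma poly_bounded_monomial_bound:
  assumes "poly_bounded f"
  shows "\<exists>c e. \<forall>n. f n \<le> c * n ^ e + c"
proof -
  obtain c e where f: "\<And>n. f n \<le> c * Suc n ^ e" using assms unfolding poly_bounded_def by blast
  have "f n \<le> c * 2 ^ e * n ^ e + c * 2 ^ e" for n
  proof -
    have "Suc n ^ e \<le> 2 ^ e * n ^ e + 2 ^ e"
    proof (cases "n = 0")
      case False
      then have "Suc n ^ e \<le> (2 * n) ^ e" by (intro power_mono) auto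
      then show ?thesis by (simp add: power_mult_distrib)
    qed (simp add: trans_le_add2)
    then have "c * Suc n ^ e \<le> c * (2 ^ e * n ^ e + 2 ^ e)" by (rule mult_le_mono2)
    then show ?thesis using f[of n] by (simp add: algebra_simps)
  qed
  then show ?thesis by blast
qed

lemma computable_imp_nuDet:
  assumes ps: "ps \<noteq> []" and f: "poly_bounded f"
    and comp: "\<And>n. \<exists>g. computable ps n (f n) [g] \<and> (\<forall>x. length x = n \<longrightarrow> g x \<longleftrightarrow> x \<in> L)"
  shows "L \<in> nuDet ps"
proof -
  obtain c e where f: "\<And>n. f n \<le> c * n ^ e + c" using poly_bounded_monomial_bound[OF f] by blast
  have "\<exists>Ls. layers_wf n ps Ls \<and> length (hd Ls) = 1 \<and> layers_size Ls \<le> c * n ^ e + c \<and>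
      (\<forall>x. length x = n \<longrightarrow> (x \<in> L \<longleftrightarrow> hd (layers_eval ps Ls x)))" for n
  proof -
    obtain g Ls where Ls: "layers_wf n ps Ls" "layers_size Ls \<le> f n"
      and ev: "\<And>x. length x = n \<Longrightarrow> layers_eval ps Ls x = [g x]"
      and g: "\<And>x. length x = n \<Longrightarrow> g x \<longleftrightarrow> x \<in> L"
      using comp[of n] unfolding computable_def by auto
    have "length (hd Ls) = 1"
      using ev[of "replicate n False"] Ls(1) ps by (cases ps; cases Ls) auto
    then show ?thesis using Ls ev g le_trans[OF Ls(2) f] by (intro exI[of _ Ls]) auto
  qed
  then show ?thesis unfolding nuDet_def using ps by blast
qed

theorem mainTheorem9:
  fixes A :: "'a set" and ops :: "'a ops"
  assumes "finite_algebra A ops" and "solvable A ops" and "has_malcev A ops"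
  shows "\<exists>ps. ps \<noteq> [] \<and> (\<forall>p\<in>set ps. prime p) \<and> nuP A ops \<subseteq> nuDet ps"
proof -
  obtain d :: "nat trm" where "malcev_algebra A ops d"
    using assms(1,3) unfolding has_malcev_def malcev_algebra_def by blast
  then interpret malcev_algebra A ops d .
  obtain k where "derived A ops k = Id_on A" using assms(2) unfolding solvable_def by blast
  then have "resolvable (Id_on A)" using resolvable_derived[of k] by simp
  then obtain ps f where ps: "\<forall>p\<in>set ps. prime p" and f: "poly_bounded f"
    and comp: "\<And>n C \<iota> v K. \<lbrakk>circuit_wf A ops n C; range \<iota> \<subseteq> A; is_run ops n C \<iota> v; n \<le> K; length C \<le> K\<rbrakk>
        \<Longrightarrow> computable ps n (f K) (state n (length C) v (Id_on A))"
    unfolding resolvable_def by metis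
  have "L \<in> nuDet (2 # ps)" if "L \<in> nuP A ops" for L
  proof -
    obtain t :: "nat \<Rightarrow> 'a cnode list" and \<iota> S c e where \<iota>: "range \<iota> \<subseteq> A" and S: "S \<subseteq> A"
      and wf: "\<And>n. n \<ge> 1 \<Longrightarrow> circuit_wf A ops n (t n)"
      and size: "\<And>n. n \<ge> 1 \<Longrightarrow> circuit_size (t n) \<le> c * n ^ e + c"
      and L: "L = {b. length b \<ge> 1 \<and> circuit_eval ops (t (length b)) (map \<iota> b) \<in> S}"
      using \<open>L \<in> nuP A ops\<close> unfolding nuP_def by blast
    obtain a where a: "a \<in> A" using A_nonempty by blast
    \<comment> \<open>A bound for both the number of inputs and the number of nodes; the final
      \<open>+ 1\<close> covers the one-node circuit that is used for \<open>n = 0\<close>.\<close>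
    let ?K = "\<lambda>n. n + (c * n ^ e + c) + 1"
    let ?q = "length elems"
    let ?f = "\<lambda>n. f (?K n) + 1 * (1 + 2 * ?K n + ?K n * ?q + 2 * 1 + 1 + 1 * card A)"
    show ?thesis
    proof (rule computable_imp_nuDet)
      show "poly_bounded ?f"
        by (intro poly_bounded_intros poly_bounded_compose[OF f])
      fix n
      \<comment> \<open>\<open>nuP\<close> leaves \<open>t 0\<close> unconstrained and excludes the
        empty word, whereas \<open>nuDet\<close> wants layers for \<open>n = 0\<close> too. A
        constant node together with the empty accepting set \<open>R\<close> rejects the empty
        word.\<close>
      define C where "C = (if n = 0 then [CConst a] else t n)"
      define R where "R = (if n = 0 then {} else S)"
      let ?v = "circuit_vals ops C \<iota>"
      have C: "circuit_wf A ops n C"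
        using wf[of n] a by (auto simp: C_def circuit_wf_def)
      have lenC: "length C \<le> ?K n"
        using size[of n] by (auto simp: C_def circuit_size_def)
      have R: "R \<subseteq> A" using S by (simp add: R_def)
      have C0: "C \<noteq> []" using C by (simp add: circuit_wf_def)
      obtain rs where rs: "set rs = R" "distinct rs"
        using finite_distinct_list finite_subset[OF R finite_A] by blast
      let ?j = "length C - 1"
      let ?F = "state n (length C) ?v (Id_on A)"
      let ?fs = "map (\<lambda>b x. (?v x ?j, b) \<in> Id_on A) rs"
      \<comment> \<open>The output node has a single value and \<open>rs\<close> is distinct, so at
        most one of the equality bits holds and their number modulo 2 decides membership in
        \<open>R\<close>. This provides the single top gate, for which 2 is an arbitrary
        prime.\<close>
      have lin: "linear_bit 2 n ?F 1 (card A) (\<lambda>x. ?v x ?j \<in> R)"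
      proof (rule linear_bit_count[where fs = ?fs and T = "{1}"])
        show "set ?fs \<subseteq> set ?F"
        proof
          fix h assume "h \<in> set ?fs"
          then obtain b where "b \<in> A" "h = (\<lambda>x. (?v x ?j, b) \<in> Id_on A)" using rs R by auto
          moreover have "?j < length C" using C0 by simp
          ultimately show "h \<in> set ?F" unfolding set_state by blast
        qed
        have "length rs = card R" using rs distinct_card by metis
        then show "length ?fs \<le> card A" using card_mono[OF finite_A R] by simp
        fix x :: "bool list" assume x: "length x = n"
        have v: "?v x ?j \<in> A" using run_closed[OF C \<iota> is_run_circuit_vals[OF C] x] C0 by simp
        have "(\<Sum>f\<leftarrow>?fs. of_bool (f x)) = (\<Sum>b\<leftarrow>rs. of_bool (?v x ?j = b) :: nat)"
        proof -
          have "(?v x ?j, b) \<in> Id_on A \<longleftrightarrow> ?v x ?j = b" for b using v by auto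
          then show ?thesis by (simp only: map_map comp_def)
        qed
        also have "\<dots> = (\<Sum>b\<in>R. of_bool (?v x ?j = b))"
          using rs by (simp add: sum_list_distinct_conv_sum_set)
        also have "\<dots> = of_bool (?v x ?j \<in> R)"
          using finite_subset[OF R finite_A] by (simp add: of_bool_def)
        finally show "?v x ?j \<in> R \<longleftrightarrow> (\<Sum>f\<leftarrow>?fs. of_bool (f x)) mod 2 \<in> {1 :: nat}" by simp
      qed simp
      have "computable (2 # ps) n (?f n) [\<lambda>x. ?v x ?j \<in> R]"
      proof (rule computable_layer_le)
        show "computable ps n (f (?K n)) ?F"
          by (rule comp[OF C \<iota> is_run_circuit_vals[OF C]]) (use lenC in auto)
        show "length ?F \<le> 1 + 2 * ?K n + ?K n * ?q" by (rule length_state_le) (use lenC in auto)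
      qed (use lin in auto)
      moreover have "?v x ?j \<in> R \<longleftrightarrow> x \<in> L" if "length x = n" for x
        using that circuit_eval_conv[OF C0, of ops \<iota> x] by (auto simp: L R_def C_def)
      ultimately show "\<exists>g. computable (2 # ps) n (?f n) [g] \<and> (\<forall>x. length x = n \<longrightarrow> g x \<longleftrightarrow> x \<in> L)"
        by blast
    qed simp
  qed
  then have "2 # ps \<noteq> [] \<and> (\<forall>p\<in>set (2 # ps). prime p) \<and> nuP A ops \<subseteq> nuDet (2 # ps)"
    using ps by auto
  then show ?thesis by blast
qed

end
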